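(* Let $\Omega\subset\mathbb{R}^2$ be a bounded, open, connected set containing the origin $O$. For a singular stress field $\boldsymbol{\sigma}\in\mathcal{A}(\Omega,\mathrm{Sym})$ and a singular body force field $\boldsymbol{B}\in\mathcal{A}(\Omega,\mathbb{R}^2)$, the equilibrium condition $\operatorname{Div}\boldsymbol{\sigma}+\boldsymbol{B}=\boldsymbol{0}$ (in the sense of distributions on $\Omega$) is equivalent to the following conditions together: (i) $\operatorname{div}(\boldsymbol{\sigma}|_{\Omega-O})+\boldsymbol{B}|_{\Omega-O}=\boldsymbol{0}$ on $\Omega-O$; (ii) $-\boldsymbol{\sigma}(\nabla(w^\alpha\boldsymbol{e}_1))+\boldsymbol{B}(w^\alpha\boldsymbol{e}_1)=0$ for all multi-indices $\alpha\in\mathbb{N}^2$ with $|\alpha|\le\deg(\boldsymbol{\sigma})+1$; (iii) $-\boldsymbol{\sigma}(\nabla(w^\alpha\boldsymbol{e}_2))+\boldsymbol{B}(w^\alpha\boldsymbol{e}_2)=0$ for all multi-indices $\alpha\in\mathbb{N}^2$ with $|\alpha|\le\deg(\boldsymbol{\sigma})+1$; (iv) $\deg(\boldsymbol{B})\le\deg(\boldsymbol{\sigma})+1$. Here, for each multi-index $\alpha$, $w^\alpha\in\mathcal{D}(\Omega)$ is a compactly supported smooth function such that for every multi-index $\beta$, $\partial^\beta w^\alpha(O)=(-1)^{|\alpha|}$ if $\beta=\alpha$ and $\partial^\beta w^\alpha(O)=0$ if $\beta\ne\alpha$.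
   Context: $\Omega-O$ means $\Omega\setminus\{O\}$; $\mathrm{Sym}$ is the space of symmetric linear maps $\mathbb{R}^2\to\mathbb{R}^2$; $\{\boldsymbol{e}_1,\boldsymbol{e}_2\}$ is the standard orthonormal basis; $\mathbb{N}$ includes $0$. For a finite-dimensional space $V$, $\mathcal{D}'(\Omega,V)$ is the space of $V$-valued distributions, acting on compactly supported smooth $V$-valued test functions by $\boldsymbol{T}(\boldsymbol{\phi})=T_i(\phi_i)$ or $T_{ij}(\phi_{ij})$ (summation convention). $\mathcal{A}(\Omega,V)$ is the set of $\boldsymbol{T}\in\mathcal{D}'(\Omega,V)$ with singular support contained in $\{O\}$; then $\boldsymbol{T}|_{\Omega-O}$ is given by a smooth function on $\Omega-O$ and is identified with it. For a vector field, $(\nabla\boldsymbol{\psi})_{ij}=\partial\psi_i/\partial x_j$. Distributional divergence: $\operatorname{Div}\boldsymbol{\sigma}(\boldsymbol{\psi})=-\boldsymbol{\sigma}(\nabla\boldsymbol{\psi})$, i.e. $(\operatorname{Div}\boldsymbol{\sigma})_i=\partial_j\sigma_{ij}$; $\operatorname{div}$ is the corresponding classical operator. Degree of divergence (with respect to $O$): choose an open ball $B_r\subset\Omega$ centred at $O$. For a test function $\phi$ on $B_r$ and $0<\lambda<1$ put $\phi_\lambda(\boldsymbol{x})=\lambda^{-2}\phi(\boldsymbol{x}/\lambda)$ and $(T|_{B_r})_\lambda(\phi)=T(\phi_\lambda)$. The scaling degree is $\operatorname{sd}(T)=\inf\{k\in\mathbb{R}:\lim_{\lambda\to0}\lambda^k(T|_{B_r})_\lambda=0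 \text{ in the sense of distributions}\}$ and $\deg(T)=\operatorname{sd}(T)-2$ (with value $-\infty$ if the infimum is over all of $\mathbb{R}$). For vector/tensor valued distributions the same definition is used with vector/tensor valued test functions (equivalently, the maximum over components). *)

theory Defs
  imports "HOL-Analysis.Analysis"
begin

section \<open>Partial derivatives and smooth functions on the plane\<close>

definition pd :: "2 \<Rightarrow> (real^2 \<Rightarrow> real) \<Rightarrow> real^2 \<Rightarrow> real"
  where "pd j f x = frechet_derivative f (at x) (axis j 1)"

primrec Ck_on :: "nat \<Rightarrow> (real^2) set \<Rightarrow> (real^2 \<Rightarrow> real) \<Rightarrow> bool"
  where
    "Ck_on 0 U f \<longleftrightarrow> continuous_on U f"
  | "Ck_on (Suc k) U f \<longleftrightarrow> (\<forall>x\<in>U. f differentiable (at x)) \<and> (\<forall>j. Ck_on k U (pd j f))"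

text \<open>Only used for open \<open>U\<close>.\<close>

definition smooth_on :: "(real^2) set \<Rightarrow> (real^2 \<Rightarrow> real) \<Rightarrow> bool"
  where "smooth_on U f \<longleftrightarrow> (\<forall>k. Ck_on k U f)"

type_synonym multi_index = "nat^2"

definition mi_order :: "multi_index \<Rightarrow> nat"
  where "mi_order \<alpha> = \<alpha> $ 1 + \<alpha> $ 2"

definition mi_deriv :: "multi_index \<Rightarrow> (real^2 \<Rightarrow> real) \<Rightarrow> real^2 \<Rightarrow> real"
  where "mi_deriv \<alpha> f = (pd 1 ^^ (\<alpha> $ 1)) ((pd 2 ^^ (\<alpha> $ 2)) f)"

definition grad :: "(real^2 \<Rightarrow> real^2) \<Rightarrow> real^2 \<Rightarrow> real^2^2"
  where "grad \<psi> x = (\<chi> i j. pd j (\<lambda>y. \<psi> y $ i) x)"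

definition div_classical :: "(real^2 \<Rightarrow> real^2^2) \<Rightarrow> real^2 \<Rightarrow> real^2"
  where "div_classical s x = (\<chi> i. \<Sum>j\<in>UNIV. pd j (\<lambda>y. s y $ i $ j) x)"

section \<open>Test functions\<close>

text \<open>Test functions on an open set \<open>U\<close> are functions on the whole plane, extended by zero
  outside \<open>U\<close>. In particular the test functions on a subset are test functions on \<open>U\<close>,
  so that restricting a distribution does not change the underlying functional.\<close>

definition test_functions :: "(real^2) set \<Rightarrow> (real^2 \<Rightarrow> real) set"
  where "test_functions U = {\<phi>. smooth_on UNIV \<phi> \<and>
    compact (closure {x. \<phi> x \<noteq> 0}) \<and> closure {x. \<phi> x \<noteq> 0} \<subseteq> U}"

definition vec_test_functions :: "(real^2) set \<Rightarrow> (real^2 \<Rightarrow> real^2) set"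
  where "vec_test_functions U = {\<psi>. \<forall>i. (\<lambda>x. \<psi> x $ i) \<in> test_functions U}"

definition sym_test_functions :: "(real^2) set \<Rightarrow> (real^2 \<Rightarrow> real^2^2) set"
  where "sym_test_functions U = {\<phi>. (\<forall>i j. (\<lambda>x. \<phi> x $ i $ j) \<in> test_functions U) \<and>
    (\<forall>x. transpose (\<phi> x) = \<phi> x)}"

section \<open>Distributions\<close>

text \<open>A distribution on \<open>U\<close> is represented by a functional on all functions; only its values on
  \<open>test_functions U\<close> are meaningful. Continuity is expressed by the seminorm estimates on
  compact subsets.\<close>

type_synonym functional = "(real^2 \<Rightarrow> real) \<Rightarrow> real"

definition distributions :: "(real^2) set \<Rightarrow> functional set"
  where "distributions U = {T.
    (\<forall>\<phi>\<in>test_functions U. \<forall>\<psi>\<in>test_functions U. T (\<lambda>x. \<phi> x + \<psi> x) = T \<phi> + T \<psi>) \<and>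
    (\<forall>c. \<forall>\<phi>\<in>test_functions U. T (\<lambda>x. c * \<phi> x) = c * T \<phi>) \<and>
    (\<forall>K. compact K \<longrightarrow> K \<subseteq> U \<longrightarrow>
      (\<exists>C N. \<forall>\<phi>\<in>test_functions U. closure {x. \<phi> x \<noteq> 0} \<subseteq> K \<longrightarrow>
        \<bar>T \<phi>\<bar> \<le> C * (\<Sum>\<alpha> | mi_order \<alpha> \<le> N. SUP x. \<bar>mi_deriv \<alpha> \<phi> x\<bar>)))}"

definition given_by :: "(real^2) set \<Rightarrow> functional \<Rightarrow> (real^2 \<Rightarrow> real) \<Rightarrow> bool"
  where "given_by U T f \<longleftrightarrow> smooth_on U f \<and>
    (\<forall>\<phi>\<in>test_functions U. T \<phi> = (LINT x|lborel. f x * \<phi> x))"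

definition singular_support :: "(real^2) set \<Rightarrow> functional \<Rightarrow> (real^2) set"
  where "singular_support \<Omega> T =
    {x\<in>\<Omega>. \<not> (\<exists>U f. open U \<and> x \<in> U \<and> U \<subseteq> \<Omega> \<and> given_by U T f)}"

definition A_scalar :: "(real^2) set \<Rightarrow> functional set"
  where "A_scalar \<Omega> = {T \<in> distributions \<Omega>. singular_support \<Omega> T \<subseteq> {0}}"

text \<open>Vector and tensor valued distributions are given by their components \<open>T\<^sub>i\<close>,
  \<open>T\<^sub>i\<^sub>j\<close>.\<close>

definition A_vec :: "(real^2) set \<Rightarrow> (functional^2) set"
  where "A_vec \<Omega> = {B. \<forall>i. B $ i \<in> A_scalar \<Omega>}"

definition A_sym :: "(real^2) set \<Rightarrow> (functional^2^2) set"
  where "A_sym \<Omega> = {\<sigma>. (\<forall>i j. \<sigma> $ i $ j \<in> A_scalar \<Omega>) \<and>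
    (\<forall>i j. \<forall>\<phi>\<in>test_functions \<Omega>. (\<sigma> $ i $ j) \<phi> = (\<sigma> $ j $ i) \<phi>)}"

definition act_vec :: "functional^2 \<Rightarrow> (real^2 \<Rightarrow> real^2) \<Rightarrow> real"
  where "act_vec B \<psi> = (\<Sum>i\<in>UNIV. (B $ i) (\<lambda>x. \<psi> x $ i))"

text \<open>The tensor field \<open>\<phi>\<close> need not be symmetric here: \<open>\<sigma>\<close> is applied to \<open>grad \<psi>\<close>.\<close>

definition act_tens :: "functional^2^2 \<Rightarrow> (real^2 \<Rightarrow> real^2^2) \<Rightarrow> real"
  where "act_tens \<sigma> \<phi> = (\<Sum>i\<in>UNIV. \<Sum>j\<in>UNIV. (\<sigma> $ i $ j) (\<lambda>x. \<phi> x $ i $ j))"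

definition Div :: "functional^2^2 \<Rightarrow> (real^2 \<Rightarrow> real^2) \<Rightarrow> real"
  where "Div \<sigma> \<psi> = - act_tens \<sigma> (grad \<psi>)"

text \<open>The smooth function representing \<open>T\<close> on the open set \<open>U\<close>. It exists for \<open>T\<close> in
  \<open>A_scalar \<Omega>\<close> and \<open>U = \<Omega> - {0}\<close>, and its values on \<open>U\<close> are unique; its values
  outside \<open>U\<close> are arbitrary and play no role.\<close>

definition smooth_rep :: "(real^2) set \<Rightarrow> functional \<Rightarrow> real^2 \<Rightarrow> real"
  where "smooth_rep U T = (SOME f. given_by U T f)"

definition smooth_rep_vec :: "(real^2) set \<Rightarrow> functional^2 \<Rightarrow> real^2 \<Rightarrow> real^2"
  where "smooth_rep_vec U B x = (\<chi> i. smooth_rep U (B $ i) x)"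

definition smooth_rep_tens :: "(real^2) set \<Rightarrow> functional^2^2 \<Rightarrow> real^2 \<Rightarrow> real^2^2"
  where "smooth_rep_tens U \<sigma> x = (\<chi> i j. smooth_rep U (\<sigma> $ i $ j) x)"

section \<open>Scaling degree and degree of divergence\<close>

definition rescale :: "real \<Rightarrow> (real^2 \<Rightarrow> 'v::real_vector) \<Rightarrow> real^2 \<Rightarrow> 'v"
  where "rescale l \<phi> x = (1 / l^2) *\<^sub>R \<phi> ((1 / l) *\<^sub>R x)"

text \<open>\<open>D\<close> is the set of (scalar, vector or tensor valued) test functions on the ball chosen around
  the origin, and \<open>T\<close> the action of the distribution on them. The infimum is taken in the
  extended reals, so it is \<open>-\<infinity>\<close> when all real \<open>k\<close> are admissible.\<close>

definition scaling_degree ::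
    "(real^2 \<Rightarrow> 'v::real_vector) set \<Rightarrow> ((real^2 \<Rightarrow> 'v) \<Rightarrow> real) \<Rightarrow> ereal"
  where "scaling_degree D T = Inf {ereal k | k.
    \<forall>\<phi>\<in>D. ((\<lambda>l. l powr k * T (rescale l \<phi>)) \<longlongrightarrow> 0) (at_right 0)}"

definition deg_vec :: "real \<Rightarrow> functional^2 \<Rightarrow> ereal"
  where "deg_vec r B = scaling_degree (vec_test_functions (ball 0 r)) (act_vec B) - 2"

definition deg_sym :: "real \<Rightarrow> functional^2^2 \<Rightarrow> ereal"
  where "deg_sym r \<sigma> = scaling_degree (sym_test_functions (ball 0 r)) (act_tens \<sigma>) - 2"

end

theory Submission
  imports Defs
begin

text \<open>Componentwise, equilibrium says that the two scalar distributions \<open>residual \<sigma> B i\<close>, the components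
  of \<open>Div \<sigma> + B\<close>, vanish. Condition (i) says exactly that they vanish on test functions supported away
  from the origin: on \<open>\<Omega> - {0}\<close> both fields are given by smooth functions (the local representatives glue,
  \<open>given_by_local\<close>), integration by parts moves the derivative onto them, and the fundamental lemma
  of the calculus of variations removes the test function.

  What remains is a distribution \<open>T\<close> concentrated at the origin. Locally it has some finite order \<open>N\<close>, and a test
  function whose derivatives up to order \<open>N\<close> vanish at \<open>0\<close> is annihilated, because it can be cut off near \<open>0\<close>
  with arbitrarily small seminorms (\<open>concentrated_vanishes\<close>). Taylor expansion with the functions \<open>w \<alpha>\<close>
  in place of monomials gives \<open>T \<phi>\<close> as a finite linear combination of derivatives of \<open>\<phi>\<close> at \<open>0\<close>, with
  coefficients \<open>T (w \<alpha>)\<close> up to sign. A derivative of order \<open>m\<close> scales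
  with the exact power \<open>-(m + 2)\<close>, so a bound on the scaling degree of \<open>T\<close> kills all coefficients of
  higher order (\<open>concentrated_eq_0\<close>). By (iv), and because \<open>Div\<close> raises the degree of \<open>\<sigma>\<close> by at most
  one (\<open>tendsto_act_tens_grad\<close>), these are the orders above \<open>deg \<sigma> + 1\<close>; the coefficients up to that
  order vanish by (ii) and (iii). Conversely, equilibrium gives (ii) and (iii) by testing with \<open>w \<alpha>\<close> in
  either direction, and (iv) because \<open>B\<close> is minus the divergence of \<open>\<sigma>\<close>.

  Derivatives are handled as \<open>fold pd u\<close> for words \<open>u\<close> of directions, which suits induction better
  than multi-indices; symmetry of the mixed derivatives (\<open>pd_commute\<close>) relates the two.\<close>

section \<open>Calculus of partial derivatives on the plane\<close>

lemma pd_eq: "(f has_derivative f') (at x) \<Longrightarrow> pd j f x = f' (axis j 1)"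
  using frechet_derivative_at[of f f' x] by (simp add: pd_def)

lemma has_derivative_pd:
  assumes "f differentiable (at x)"
  shows "(f has_derivative (\<lambda>v. \<Sum>j\<in>UNIV. v $ j * pd j f x)) (at x)"
proof -
  have D: "(f has_derivative frechet_derivative f (at x)) (at x)"
    using assms frechet_derivative_works by blast
  then interpret bounded_linear "frechet_derivative f (at x)"
    by (rule has_derivative_bounded_linear)
  have "frechet_derivative f (at x) v = (\<Sum>j\<in>UNIV. v $ j * pd j f x)" for v
  proof -
    have "frechet_derivative f (at x) v = frechet_derivative f (at x) (\<Sum>j\<in>UNIV. (v $ j) *\<^sub>R axis j 1)"
      using basis_expansion[of v] by (simp add: scalar_mult_eq_scaleR)
    then show ?thesis by (simp add: sum scale pd_def)
  qed
  then have "frechet_derivative f (at x) = (\<lambda>v. \<Sum>j\<in>UNIV. v $ j * pd j f x)" by blast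
  with D show ?thesis by simp
qed

lemma pd_const [simp]: "pd j (\<lambda>x. c) = (\<lambda>x. 0)"
  by (rule ext) (rule pd_eq[OF has_derivative_const])

lemma pd_add:
  assumes "f differentiable (at x)" "g differentiable (at x)"
  shows "pd j (\<lambda>x. f x + g x) x = pd j f x + pd j g x"
  using pd_eq[OF has_derivative_add[OF assms[unfolded frechet_derivative_works]]]
  by (simp add: pd_def)

lemma pd_mult:
  assumes "f differentiable (at x)" "g differentiable (at x)"
  shows "pd j (\<lambda>x. f x * g x) x = pd j f x * g x + f x * pd j g x"
  using pd_eq[OF has_derivative_mult[OF assms[unfolded frechet_derivative_works]]]
  by (simp add: pd_def add.commute)

lemma pd_cmult:
  "f differentiable (at x) \<Longrightarrow> pd j (\<lambda>x. c * f x) x = c * pd j f x"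
  using pd_mult[of "\<lambda>x. c" x f j] by simp

lemma sum_axis: "(\<Sum>k\<in>UNIV. axis j (1::real) $ k * p k) = p (j :: 2)"
  by (subst sum.remove[of _ j]) (auto simp: axis_def intro!: sum.neutral)

lemma pd_compose:
  assumes "(h has_real_derivative h') (at (f x))" "f differentiable (at x)"
  shows "pd j (\<lambda>x. h (f x)) x = h' * pd j f x"
proof -
  have "(h has_derivative (\<lambda>v. h' * v)) (at (f x))"
    using assms(1) by (simp add: has_field_derivative_def)
  from pd_eq[OF has_derivative_compose[OF has_derivative_pd[OF assms(2)] this], of j]
  show ?thesis by (simp add: sum_axis)
qed

lemma pd_affine:
  assumes "f differentiable (at (s *\<^sub>R (x - c)))"
  shows "pd j (\<lambda>x. f (s *\<^sub>R (x - c))) x = s * pd j f (s *\<^sub>R (x - c))"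
proof -
  let ?F = "\<lambda>v. \<Sum>j\<in>UNIV. v $ j * pd j f (s *\<^sub>R (x - c))"
  have "((\<lambda>x. s *\<^sub>R (x - c)) has_derivative (\<lambda>v. s *\<^sub>R v)) (at x)"
    by (auto intro!: derivative_eq_intros)
  from has_derivative_compose[OF this has_derivative_pd[OF assms]]
  have "pd j (\<lambda>x. f (s *\<^sub>R (x - c))) x = ?F (s *\<^sub>R axis j 1)" by (rule pd_eq)
  also have "\<dots> = s * ?F (axis j 1)"
    by (simp add: sum_distrib_left mult.assoc)
  also have "?F (axis j 1) = pd j f (s *\<^sub>R (x - c))"
    by (rule sum_axis)
  finally show ?thesis .
qed

lemma differentiable_cong_open:
  assumes "open U" "x \<in> U" "\<And>y. y \<in> U \<Longrightarrow> f y = g y" "f differentiable (at x)"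
  shows "g differentiable (at x)"
proof -
  obtain f' where "(f has_derivative f') (at x)" using assms(4) unfolding differentiable_def by blast
  then have "(g has_derivative f') (at x)"
    by (rule has_derivative_transform_within_open) (use assms in auto)
  then show ?thesis unfolding differentiable_def by blast
qed

lemma pd_cong_open:
  assumes "open U" "x \<in> U" "\<And>y. y \<in> U \<Longrightarrow> f y = g y"
  shows "pd j f x = pd j g x"
proof -
  have "(f has_derivative f') (at x) \<longleftrightarrow> (g has_derivative f') (at x)" for f'
    using assms has_derivative_transform_within_open[OF _ assms(1,2), of f f' UNIV g]
      has_derivative_transform_within_open[OF _ assms(1,2), of g f' UNIV f] by metis
  then show ?thesis unfolding pd_def frechet_derivative_def by simp
qed

lemma mean_value_pd:
  assumes "\<And>x. f differentiable (at x)"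
  shows "\<exists>t\<in>{0<..<1}. f (a + v) - f a = (\<Sum>j\<in>UNIV. v $ j * pd j f (a + t *\<^sub>R v))"
proof -
  have "((\<lambda>t. f (a + t *\<^sub>R v)) has_derivative (\<lambda>s. s * (\<Sum>j\<in>UNIV. v $ j * pd j f (a + t *\<^sub>R v))))
      (at t within {0..1})" for t :: real
  proof -
    have "((\<lambda>t. a + t *\<^sub>R v) has_derivative (\<lambda>s. s *\<^sub>R v)) (at t within {0..1})"
      by (auto intro!: derivative_eq_intros)
    from has_derivative_compose[OF this has_derivative_pd[OF assms]]
    show ?thesis by (simp add: sum_distrib_left mult.assoc)
  qed
  from mvt_simple[OF zero_less_one this] show ?thesis by auto
qed

section \<open>Smooth functions\<close>

lemma Ck_on_subset: "Ck_on k U f \<Longrightarrow> V \<subseteq> U \<Longrightarrow> Ck_on k V f"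
  by (induction k arbitrary: f) (auto intro: continuous_on_subset)

lemma Ck_on_Suc: "open U \<Longrightarrow> Ck_on (Suc k) U f \<Longrightarrow> Ck_on k U f"
proof (induction k arbitrary: f)
  case 0
  then show ?case
    by (auto intro!: continuous_at_imp_continuous_on differentiable_imp_continuous_within)
next
  case (Suc k)
  show ?case using Suc.prems Suc.IH[OF Suc.prems(1)]
    by (metis Ck_on.simps(2))
qed

lemma Ck_on_cong:
  "open U \<Longrightarrow> (\<And>x. x \<in> U \<Longrightarrow> f x = g x) \<Longrightarrow> Ck_on k U f \<Longrightarrow> Ck_on k U g"
proof (induction k arbitrary: f g)
  case 0
  then show ?case by (metis Ck_on.simps(1) continuous_on_cong)
next
  case (Suc k)
  have "Ck_on k U (pd j g)" for j
    using Suc.IH[of "pd j f" "pd j g"] Suc.prems pd_cong_open[of U _ f g] by auto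
  then show ?case using Suc.prems differentiable_cong_open[of U _ f g] by auto
qed

lemma Ck_on_local:
  "(\<And>x. x \<in> U \<Longrightarrow> \<exists>V. open V \<and> x \<in> V \<and> Ck_on k V f) \<Longrightarrow> Ck_on k U f"
proof (induction k arbitrary: f)
  case 0
  have "isCont f x" if "x \<in> U" for x
    using 0[OF that] by (auto simp: continuous_on_eq_continuous_at)
  then show ?case by (simp add: continuous_at_imp_continuous_on)
next
  case (Suc k)
  have "Ck_on k U (pd j f)" for j using Suc.prems by (intro Suc.IH) fastforce
  moreover have "f differentiable (at x)" if "x \<in> U" for x using Suc.prems[OF that] by auto
  ultimately show ?case by simp
qed

lemma Ck_on_const: "Ck_on k U (\<lambda>x. c)"
  by (induction k arbitrary: c) auto

lemma Ck_on_coord: "Ck_on k U (\<lambda>x. x $ i)"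
proof (cases k)
  case 0
  then show ?thesis by (auto intro: continuous_intros)
next
  case (Suc l)
  have D: "((\<lambda>x::real^2. x $ i) has_derivative (\<lambda>v. v $ i)) (at x)" for x
    by (rule bounded_linear_imp_has_derivative) (rule bounded_linear_vec_nth)
  have "pd j (\<lambda>x. x $ i) = (\<lambda>x. axis j 1 $ i)" for j
    using pd_eq[OF D] by blast
  then show ?thesis using Suc D Ck_on_const[of l U] by (auto simp: differentiable_def)
qed

lemma Ck_on_add:
  "open U \<Longrightarrow> Ck_on k U f \<Longrightarrow> Ck_on k U g \<Longrightarrow> Ck_on k U (\<lambda>x. f x + g x)"
proof (induction k arbitrary: f g)
  case 0
  then show ?case by (auto intro: continuous_intros)
next
  case (Suc k)
  have "Ck_on k U (pd j (\<lambda>x. f x + g x))" for j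
    by (rule Ck_on_cong[OF \<open>open U\<close> _ Suc.IH[of "pd j f" "pd j g"]])
      (use Suc.prems in \<open>auto simp: pd_add\<close>)
  then show ?case using Suc.prems by auto
qed

lemma Ck_on_mult:
  "open U \<Longrightarrow> Ck_on k U f \<Longrightarrow> Ck_on k U g \<Longrightarrow> Ck_on k U (\<lambda>x. f x * g x)"
proof (induction k arbitrary: f g)
  case 0
  then show ?case by (auto intro: continuous_intros)
next
  case (Suc k)
  have *: "Ck_on k U f" "Ck_on k U g" using Suc.prems Ck_on_Suc by blast+
  have "Ck_on k U (pd j (\<lambda>x. f x * g x))" for j
    by (rule Ck_on_cong[OF \<open>open U\<close> _ Ck_on_add[OF \<open>open U\<close>
            Suc.IH[of "pd j f" g] Suc.IH[of f "pd j g"]]])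
      (use Suc.prems * in \<open>auto simp: pd_mult\<close>)
  then show ?case using Suc.prems by (auto intro: differentiable_mult)
qed

lemma Ck_on_inverse:
  "open U \<Longrightarrow> Ck_on k U f \<Longrightarrow> (\<And>x. x \<in> U \<Longrightarrow> f x \<noteq> 0) \<Longrightarrow> Ck_on k U (\<lambda>x. inverse (f x))"
proof (induction k)
  case 0
  then show ?case by (auto intro: continuous_intros)
next
  case (Suc k)
  let ?i = "\<lambda>x. inverse (f x)"
  have i: "Ck_on k U ?i" using Suc Ck_on_Suc by blast
  have D: "pd j ?i x = - (?i x * ?i x) * pd j f x" if "x \<in> U" for j x
    using that Suc.prems pd_compose[of inverse "- (?i x * ?i x)" f x j] DERIV_inverse[of "f x" UNIV]
    by (simp add: power2_eq_square)
  have "Ck_on k U (pd j ?i)" for j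
  proof (rule Ck_on_cong[OF \<open>open U\<close>])
    show "Ck_on k U (\<lambda>x. (- 1) * (?i x * ?i x) * pd j f x)"
      using Suc.prems i by (intro Ck_on_mult Ck_on_const) auto
  qed (use D in auto)
  then show ?case using Suc.prems by (auto intro: differentiable_inverse)
qed

lemma smooth_on_subset: "smooth_on U f \<Longrightarrow> V \<subseteq> U \<Longrightarrow> smooth_on V f"
  unfolding smooth_on_def using Ck_on_subset by blast

lemma smooth_on_local:
  "(\<And>x. x \<in> U \<Longrightarrow> \<exists>V. open V \<and> x \<in> V \<and> smooth_on V f) \<Longrightarrow> smooth_on U f"
  unfolding smooth_on_def by (meson Ck_on_local)

lemma smooth_on_cong:
  "open U \<Longrightarrow> (\<And>x. x \<in> U \<Longrightarrow> f x = g x) \<Longrightarrow> smooth_on U f \<Longrightarrow> smooth_on U g"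
  unfolding smooth_on_def using Ck_on_cong by blast

lemma smooth_on_continuous: "smooth_on U f \<Longrightarrow> continuous_on U f"
  unfolding smooth_on_def using Ck_on.simps(1) by blast

lemma smooth_on_differentiable: "smooth_on U f \<Longrightarrow> x \<in> U \<Longrightarrow> f differentiable (at x)"
  unfolding smooth_on_def using Ck_on.simps(2) by blast

lemma smooth_on_pd: "smooth_on U f \<Longrightarrow> smooth_on U (pd j f)"
  unfolding smooth_on_def using Ck_on.simps(2) by blast

lemma smooth_on_add:
  "open U \<Longrightarrow> smooth_on U f \<Longrightarrow> smooth_on U g \<Longrightarrow> smooth_on U (\<lambda>x. f x + g x)"
  unfolding smooth_on_def by (simp add: Ck_on_add)

lemma smooth_on_mult:
  "open U \<Longrightarrow> smooth_on U f \<Longrightarrow> smooth_on U g \<Longrightarrow> smooth_on U (\<lambda>x. f x * g x)"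
  unfolding smooth_on_def by (simp add: Ck_on_mult)

lemma smooth_on_const: "smooth_on U (\<lambda>x. c)"
  unfolding smooth_on_def by (simp add: Ck_on_const)

lemma smooth_on_affine:
  assumes "smooth_on UNIV f"
  shows "smooth_on UNIV (\<lambda>x. f (s *\<^sub>R (x - c)))"
proof -
  have "Ck_on k UNIV f \<Longrightarrow> Ck_on k UNIV (\<lambda>x. f (s *\<^sub>R (x - c)))" for k
  proof (induction k arbitrary: f)
    case 0
    then show ?case
      by (auto intro!: continuous_intros elim!: continuous_on_compose2)
  next
    case (Suc k)
    have "pd j (\<lambda>x. f (s *\<^sub>R (x - c))) = (\<lambda>x. s * pd j f (s *\<^sub>R (x - c)))" for j
      using Suc.prems pd_affine by fastforce
    moreover have "Ck_on k UNIV (\<lambda>x. s * pd j f (s *\<^sub>R (x - c)))" for j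
      using Suc.prems by (intro Ck_on_mult Ck_on_const Suc.IH) auto
    moreover have "(\<lambda>x. f (s *\<^sub>R (x - c))) differentiable (at x)" for x
    proof -
      have D: "((\<lambda>x. s *\<^sub>R (x - c)) has_derivative (\<lambda>v. s *\<^sub>R v)) (at x)"
        by (auto intro!: derivative_eq_intros)
      have "f differentiable (at (s *\<^sub>R (x - c)))" using Suc.prems by simp
      from has_derivative_compose[OF D has_derivative_pd[OF this]]
      show ?thesis unfolding differentiable_def by blast
    qed
    ultimately show ?case by simp
  qed
  with assms show ?thesis unfolding smooth_on_def by blast
qed

subsection \<open>Iterated partial derivatives\<close>

lemma smooth_on_fold_pd: "smooth_on U f \<Longrightarrow> smooth_on U (fold pd u f)"
  by (induction u arbitrary: f) (auto intro: smooth_on_pd)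

lemma fold_pd_cong_open:
  "open U \<Longrightarrow> (\<And>y. y \<in> U \<Longrightarrow> f y = g y) \<Longrightarrow> x \<in> U \<Longrightarrow> fold pd u f x = fold pd u g x"
proof (induction u arbitrary: f g)
  case (Cons j u)
  have "pd j f y = pd j g y" if "y \<in> U" for y
    by (rule pd_cong_open[OF Cons.prems(1) that Cons.prems(2)])
  from Cons.IH[OF Cons.prems(1) this Cons.prems(3)] show ?case by simp
qed simp

lemma fold_pd_zero [simp]: "fold pd u (\<lambda>x. 0) = (\<lambda>x. 0)"
  by (induction u) auto

lemma fold_pd_add:
  assumes "smooth_on UNIV f" "smooth_on UNIV g"
  shows "fold pd u (\<lambda>x. f x + g x) = (\<lambda>x. fold pd u f x + fold pd u g x)"
  using assms
proof (induction u arbitrary: f g)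
  case (Cons j u)
  have "pd j (\<lambda>x. f x + g x) = (\<lambda>x. pd j f x + pd j g x)"
    using Cons.prems by (auto simp: pd_add smooth_on_differentiable)
  then show ?case using Cons by (simp add: smooth_on_pd)
qed auto

lemma fold_pd_cmult:
  assumes "smooth_on UNIV f"
  shows "fold pd u (\<lambda>x. c * f x) = (\<lambda>x. c * fold pd u f x)"
  using assms
proof (induction u arbitrary: f)
  case (Cons j u)
  have "pd j (\<lambda>x. c * f x) = (\<lambda>x. c * pd j f x)"
    using Cons.prems by (auto simp: pd_cmult smooth_on_differentiable)
  then show ?case using Cons by (simp add: smooth_on_pd)
qed auto

lemma fold_pd_affine:
  assumes "smooth_on UNIV f"
  shows "fold pd u (\<lambda>x. f (s *\<^sub>R (x - c))) = (\<lambda>x. s ^ length u * fold pd u f (s *\<^sub>R (x - c)))"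
  using assms
proof (induction u arbitrary: f)
  case (Cons j u)
  have "pd j (\<lambda>x. f (s *\<^sub>R (x - c))) = (\<lambda>x. s * pd j f (s *\<^sub>R (x - c)))"
    using Cons.prems by (auto simp: pd_affine smooth_on_differentiable)
  then show ?case using Cons
    by (simp add: smooth_on_pd fold_pd_cmult smooth_on_affine mult.assoc)
qed auto

text \<open>A version of the Leibniz rule without binomial coefficients: weights that are geometric in the
  order of differentiation survive multiplication, because each derivative of a product is a sum of
  two products in which one factor has been differentiated once.\<close>

lemma fold_pd_mult_bound:
  assumes "smooth_on UNIV f" "smooth_on UNIV g" "0 \<le> A" "0 \<le> B" "0 \<le> t"
    and "\<And>v. length v \<le> n \<Longrightarrow> \<bar>fold pd v f x\<bar> \<le> A * t ^ length v"
    and "\<And>v. length v \<le> n \<Longrightarrow> \<bar>fold pd v g x\<bar> \<le> B * t ^ length v"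
    and "length u \<le> n"
  shows "\<bar>fold pd u (\<lambda>x. f x * g x) x\<bar> \<le> A * B * (2 * t) ^ length u"
  using assms
proof (induction u arbitrary: f g A B n)
  case Nil
  have "\<bar>f x\<bar> \<le> A" "\<bar>g x\<bar> \<le> B" using Nil.prems(6)[of "[]"] Nil.prems(7)[of "[]"] by auto
  then show ?case using Nil.prems by (auto simp: abs_mult intro: mult_mono)
next
  case (Cons j u)
  obtain m where n: "n = Suc m" "length u \<le> m" using Cons.prems(8) by (cases n) auto
  have s: "smooth_on UNIV (\<lambda>x. pd j f x * g x)" "smooth_on UNIV (\<lambda>x. f x * pd j g x)"
    using Cons.prems by (auto intro: smooth_on_mult smooth_on_pd)
  have "pd j (\<lambda>x. f x * g x) = (\<lambda>x. pd j f x * g x + f x * pd j g x)"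
    using Cons.prems by (auto simp: pd_mult smooth_on_differentiable)
  then have eq: "fold pd (j # u) (\<lambda>x. f x * g x) x =
      fold pd u (\<lambda>x. pd j f x * g x) x + fold pd u (\<lambda>x. f x * pd j g x) x"
    using fold_pd_add[OF s] by simp
  have f': "\<bar>fold pd v (pd j f) x\<bar> \<le> (A * t) * t ^ length v" if "length v \<le> m" for v
    using Cons.prems(6)[of "j # v"] that n by (simp add: mult.assoc)
  have g': "\<bar>fold pd v (pd j g) x\<bar> \<le> (B * t) * t ^ length v" if "length v \<le> m" for v
    using Cons.prems(7)[of "j # v"] that n by (simp add: mult.assoc)
  have "\<bar>fold pd u (\<lambda>x. pd j f x * g x) x\<bar> \<le> (A * t) * B * (2 * t) ^ length u"
    using Cons.prems n f' by (intro Cons.IH[of _ _ _ _ m]) (auto intro: smooth_on_pd)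
  moreover have "\<bar>fold pd u (\<lambda>x. f x * pd j g x) x\<bar> \<le> A * (B * t) * (2 * t) ^ length u"
    using Cons.prems n g' by (intro Cons.IH[of _ _ _ _ m]) (auto intro: smooth_on_pd)
  ultimately show ?case unfolding eq by (simp add: algebra_simps)
qed

text \<open>Two applications of the mean value theorem. The left-hand side is invariant under exchanging \<open>i\<close>
  and \<open>j\<close>, so it also equals the other mixed derivative at some other nearby point.\<close>

lemma second_difference_pd:
  assumes f: "smooth_on UNIV f"
  shows "\<exists>\<xi>. dist \<xi> a \<le> 2 * \<bar>h\<bar> \<and>
    f (a + h *\<^sub>R axis i 1 + h *\<^sub>R axis j 1) - f (a + h *\<^sub>R axis i 1) - f (a + h *\<^sub>R axis j 1) + f a
      = h ^ 2 * pd i (pd j f) \<xi>"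
proof -
  have ax: "(\<Sum>k\<in>UNIV. h * axis l (1::real) $ k * p k) = h * p l" for l :: 2 and p
    using sum_axis[of l p] by (simp add: mult.assoc flip: sum_distrib_left)
  \<comment> \<open>The mean value theorem is applied to this difference in direction \<open>j\<close>, and then to \<open>pd j f\<close> in
    direction \<open>i\<close>.\<close>
  let ?g = "\<lambda>x. f (x + h *\<^sub>R axis i 1) - f x"
  have trans: "smooth_on UNIV (\<lambda>x. f (x + h *\<^sub>R axis i 1))"
    using smooth_on_affine[OF f, of 1 "- (h *\<^sub>R axis i 1)"] by simp
  have ptrans: "pd j (\<lambda>x. f (x + h *\<^sub>R axis i 1)) x = pd j f (x + h *\<^sub>R axis i 1)" for x
    using pd_affine[of f 1 x "- (h *\<^sub>R axis i 1)" j] f by (simp add: smooth_on_differentiable)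
  have dg: "?g differentiable (at x)" for x
    using trans f by (intro differentiable_diff) (auto simp: smooth_on_differentiable)
  have pg: "pd j ?g x = pd j f (x + h *\<^sub>R axis i 1) - pd j f x" for x
    using pd_add[of "\<lambda>x. f (x + h *\<^sub>R axis i 1)" x "\<lambda>x. - 1 * f x" j] pd_cmult[of f x j "-1"] trans f
    by (simp add: smooth_on_differentiable ptrans)
  obtain s where s: "s \<in> {0<..<1}" "?g (a + h *\<^sub>R axis j 1) - ?g a = h * pd j ?g (a + s *\<^sub>R h *\<^sub>R axis j 1)"
    using mean_value_pd[OF dg, of a "h *\<^sub>R axis j 1"] by (auto simp: ax simp del: scaleR_scaleR)
  let ?b = "a + s *\<^sub>R h *\<^sub>R axis j 1"
  obtain t where t: "t \<in> {0<..<1}"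
    "pd j f (?b + h *\<^sub>R axis i 1) - pd j f ?b = h * pd i (pd j f) (?b + t *\<^sub>R h *\<^sub>R axis i 1)"
    using mean_value_pd[of "pd j f" ?b "h *\<^sub>R axis i 1"] smooth_on_differentiable[OF smooth_on_pd[OF f]]
    by (auto simp: ax simp del: scaleR_scaleR)
  let ?\<xi> = "?b + t *\<^sub>R h *\<^sub>R axis i 1"
  have "dist ?\<xi> a \<le> norm (s *\<^sub>R h *\<^sub>R axis j (1::real)) + norm (t *\<^sub>R h *\<^sub>R axis i (1::real))"
    by (metis (no_types, lifting) add.assoc add_diff_cancel_left' dist_norm norm_triangle_ineq)
  also have "\<dots> = s * \<bar>h\<bar> + t * \<bar>h\<bar>"
    using s t by (simp add: abs_mult)
  also have "\<dots> \<le> 1 * \<bar>h\<bar> + 1 * \<bar>h\<bar>"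
    using s t by (intro add_mono mult_right_mono) auto
  finally have "dist ?\<xi> a \<le> 2 * \<bar>h\<bar>" by simp
  moreover have "f (a + h *\<^sub>R axis i 1 + h *\<^sub>R axis j 1) - f (a + h *\<^sub>R axis i 1) - f (a + h *\<^sub>R axis j 1) + f a
      = h ^ 2 * pd i (pd j f) ?\<xi>"
    using s(2) t(2) unfolding pg
    by (simp add: power2_eq_square algebra_simps)
  ultimately show ?thesis by blast
qed

text \<open>Divided by the area of the square, the second difference with corner \<open>a\<close> tends to both mixed
  derivatives at \<open>a\<close>.\<close>

lemma pd_commute:
  assumes f: "smooth_on UNIV f"
  shows "pd i (pd j f) = pd j (pd i f)"
proof
  fix a
  define h where "h n = 1 / real (Suc n)" for n
  let ?Q = "\<lambda>n. f (a + h n *\<^sub>R axis i 1 + h n *\<^sub>R axis j 1) - f (a + h n *\<^sub>R axis i 1) - f (a + h n *\<^sub>R axis j 1) + f a"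
  have h0: "h \<longlonglongrightarrow> 0" unfolding h_def by (rule lim_1_over_n[THEN LIMSEQ_Suc])
  have hn: "h n \<noteq> 0" for n unfolding h_def by simp
  have lim: "(\<lambda>n. ?Q n / h n ^ 2) \<longlonglongrightarrow> pd k (pd l f) a" if "(k = i \<and> l = j) \<or> (k = j \<and> l = i)" for k l
  proof -
    have "\<exists>\<xi>. dist \<xi> a \<le> 2 * \<bar>h n\<bar> \<and> ?Q n = h n ^ 2 * pd k (pd l f) \<xi>" for n
      using second_difference_pd[OF f, of a "h n" k l] that
      by (auto simp: algebra_simps)
    then obtain \<xi> where \<xi>: "\<And>n. dist (\<xi> n) a \<le> 2 * \<bar>h n\<bar>" "\<And>n. ?Q n = h n ^ 2 * pd k (pd l f) (\<xi> n)"
      by metis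
    have lim0: "(\<lambda>n. 2 * \<bar>h n\<bar>) \<longlonglongrightarrow> 0"
      using tendsto_mult_right[OF tendsto_rabs_zero[OF h0], of 2] by simp
    have "(\<lambda>n. dist (\<xi> n) a) \<longlonglongrightarrow> 0"
      by (rule tendsto_sandwich[OF _ _ tendsto_const lim0]) (simp_all add: \<xi>(1))
    then have "\<xi> \<longlonglongrightarrow> a" by (rule tendsto_dist_iff[THEN iffD2])
    moreover have "isCont (pd k (pd l f)) a"
      using smooth_on_continuous[OF smooth_on_pd[OF smooth_on_pd[OF f]]]
      by (simp add: continuous_on_eq_continuous_at)
    ultimately have "(\<lambda>n. pd k (pd l f) (\<xi> n)) \<longlonglongrightarrow> pd k (pd l f) a"
      by (metis isCont_tendsto_compose)
    then show ?thesis using \<xi>(2) hn by simp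
  qed
  show "pd i (pd j f) a = pd j (pd i f) a"
    using LIMSEQ_unique[OF lim[of i j] lim[of j i]] by simp
qed

lemma mi_deriv_fold:
  "mi_deriv \<alpha> f = fold pd (replicate (\<alpha> $ 2) 2 @ replicate (\<alpha> $ 1) 1) f"
proof -
  have "fold pd (replicate n j) g = (pd j ^^ n) g" for n j g
    by (induction n arbitrary: g) (auto simp: funpow_swap1)
  then show ?thesis by (simp add: mi_deriv_def)
qed

lemma fold_pd_commute:
  assumes "smooth_on UNIV f"
  shows "fold pd u (pd j f) = pd j (fold pd u f)"
  using assms
proof (induction u arbitrary: f)
  case (Cons i u)
  then show ?case by (simp add: smooth_on_pd pd_commute[of f i j])
qed simp

lemma fold_pd_eq_mi_deriv:
  assumes "smooth_on UNIV f"
  shows "\<exists>\<beta>. mi_order \<beta> = length u \<and> fold pd u f = mi_deriv \<beta> f"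
  using assms
proof (induction u arbitrary: f)
  case Nil
  show ?case by (rule exI[of _ 0]) (simp add: mi_order_def mi_deriv_def)
next
  case (Cons j u)
  then obtain \<beta> where \<beta>: "mi_order \<beta> = length u" "fold pd u (pd j f) = mi_deriv \<beta> (pd j f)"
    using smooth_on_pd by blast
  let ?\<gamma> = "\<beta> + axis j 1"
  have "mi_order ?\<gamma> = Suc (length u)"
    using \<beta>(1) exhaust_2[of j] by (auto simp: mi_order_def axis_def)
  moreover have "mi_deriv \<beta> (pd j f) = mi_deriv ?\<gamma> f"
  proof (cases "j = 1")
    case True
    have "(pd 2 ^^ n) (pd 1 f) = pd 1 ((pd 2 ^^ n) f)" for n
      using fold_pd_commute[OF Cons.prems, of "replicate n 2" 1] by simp
    then have "mi_deriv \<beta> (pd 1 f) = (pd 1 ^^ Suc (\<beta> $ 1)) ((pd 2 ^^ (\<beta> $ 2)) f)"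
      by (simp add: mi_deriv_def funpow_swap1)
    with True show ?thesis by (simp add: mi_deriv_def axis_def)
  next
    case False
    then have "j = 2" using exhaust_2 by blast
    then show ?thesis by (simp add: mi_deriv_def axis_def funpow_swap1)
  qed
  ultimately show ?case using \<beta> by (intro exI[of _ ?\<gamma>]) simp
qed

section \<open>Smooth cutoff functions\<close>

text \<open>For \<open>n = 0\<close> this is the standard smooth function that is flat at \<open>0\<close>.
  The factors \<open>1 / t ^ n\<close> make the family closed under differentiation.\<close>

definition flat_exp :: "nat \<Rightarrow> real \<Rightarrow> real"
  where "flat_exp n t = (if t \<le> 0 then 0 else inverse t ^ n / exp (inverse t))"

lemma flat_exp_nonneg: "0 \<le> flat_exp n t"
  by (simp add: flat_exp_def)

lemma flat_exp_pos: "0 < t \<Longrightarrow> 0 < flat_exp n t"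
  by (simp add: flat_exp_def)

lemma flat_exp_tendsto_0: "(flat_exp n \<longlongrightarrow> 0) (at 0)"
proof -
  have "((\<lambda>t. inverse t ^ n / exp (inverse t)) \<longlongrightarrow> 0) (at_right (0::real))"
    using filterlim_compose[OF tendsto_power_div_exp_0 filterlim_inverse_at_top_right] .
  then have "(flat_exp n \<longlongrightarrow> 0) (at_right 0)"
    by (rule Lim_transform_eventually) (auto simp: flat_exp_def eventually_at_filter)
  moreover have "(flat_exp n \<longlongrightarrow> 0) (at_left 0)"
    by (rule Lim_transform_eventually[OF tendsto_const]) (auto simp: flat_exp_def eventually_at_filter)
  ultimately show ?thesis by (simp add: filterlim_at_split)
qed

lemma DERIV_flat_exp:
  "(flat_exp n has_real_derivative flat_exp (n + 2) t - real n * flat_exp (n + 1) t) (at t)"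
proof -
  consider "t < 0" | "t = 0" | "t > 0" by linarith
  then show ?thesis
  proof cases
    case 1
    have "((\<lambda>t. 0) has_real_derivative 0) (at t)" by simp
    then have "(flat_exp n has_real_derivative 0) (at t)"
      by (rule has_field_derivative_transform_within_open[where S = "{..<0}"])
        (use 1 in \<open>auto simp: flat_exp_def\<close>)
    with 1 show ?thesis by (simp add: flat_exp_def)
  next
    case 2
    have "(\<lambda>h. (flat_exp n (0 + h) - flat_exp n 0) / h) = flat_exp (Suc n)"
      by (auto simp: flat_exp_def field_simps)
    then have "(flat_exp n has_real_derivative 0) (at 0)"
      using flat_exp_tendsto_0[of "Suc n"] unfolding DERIV_def by metis
    with 2 show ?thesis by (simp add: flat_exp_def)
  next
    case 3
    \<comment> \<open>The rule for the derivative of a power leaves an exponent \<open>k - Suc 0\<close>.\<close>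
    have pw: "t * t ^ (k - Suc 0) = (if k = 0 then t else t ^ k)" for k
      by (cases k) auto
    have "((\<lambda>t. inverse t ^ n / exp (inverse t)) has_real_derivative
        (inverse t ^ (n + 2) - real n * inverse t ^ (n + 1)) / exp (inverse t)) (at t)"
      using 3 by (cases n)
        (auto intro!: derivative_eq_intros simp: field_simps power2_eq_square pw)
    then have "(flat_exp n has_real_derivative
        (inverse t ^ (n + 2) - real n * inverse t ^ (n + 1)) / exp (inverse t)) (at t)"
      by (rule has_field_derivative_transform_within_open[where S = "{0<..}"])
        (use 3 in \<open>auto simp: flat_exp_def\<close>)
    moreover have "(inverse t ^ (n + 2) - real n * inverse t ^ (n + 1)) / exp (inverse t) =
        flat_exp (n + 2) t - real n * flat_exp (n + 1) t"
      using 3 by (simp add: flat_exp_def diff_divide_distrib)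
    ultimately show ?thesis by simp
  qed
qed

lemma Ck_on_flat_exp:
  "open U \<Longrightarrow> Ck_on k U g \<Longrightarrow> Ck_on k U (\<lambda>x. flat_exp n (g x))"
proof (induction k arbitrary: n)
  case 0
  have "continuous_on UNIV (flat_exp n)"
    by (auto intro!: continuous_at_imp_continuous_on DERIV_isCont DERIV_flat_exp)
  with 0 show ?case by (auto elim!: continuous_on_compose2)
next
  case (Suc k)
  have IH: "Ck_on k U (\<lambda>x. flat_exp m (g x))" for m
    using Suc Ck_on_Suc by blast
  have "Ck_on k U (pd j (\<lambda>x. flat_exp n (g x)))" for j
  proof (rule Ck_on_cong[OF \<open>open U\<close>])
    show "Ck_on k U (\<lambda>x. (flat_exp (n + 2) (g x) + (- real n) * flat_exp (n + 1) (g x)) * pd j g x)"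
      using Suc.prems by (intro Ck_on_mult Ck_on_add Ck_on_const IH) auto
    show "(flat_exp (n + 2) (g x) + (- real n) * flat_exp (n + 1) (g x)) * pd j g x
        = pd j (\<lambda>x. flat_exp n (g x)) x" if "x \<in> U" for x
      using pd_compose[OF DERIV_flat_exp, where f = g and x = x and j = j and n1 = n] that Suc.prems by simp
  qed
  moreover have "(\<lambda>x. flat_exp n (g x)) differentiable (at x)" if x: "x \<in> U" for x
  proof -
    have "(flat_exp n has_derivative (\<lambda>v. (flat_exp (n + 2) (g x) - real n * flat_exp (n + 1) (g x)) * v)) (at (g x))"
      using DERIV_flat_exp by (simp add: has_field_derivative_def)
    from has_derivative_compose[OF has_derivative_pd[of g x] this]
    show ?thesis using Suc.prems x unfolding differentiable_def by (metis Ck_on.simps(2) differentiable_def)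
  qed
  ultimately show ?case by simp
qed

text \<open>The function is \<open>a / (a + b)\<close> with a flat \<open>a\<close> that vanishes outside the unit ball and a flat
  \<open>b\<close> that vanishes on the ball of radius \<open>1/2\<close>; the radii overlap, so that \<open>a + b\<close> is positive.\<close>

lemma exists_cutoff_at_0:
  "\<exists>\<theta>. smooth_on UNIV \<theta> \<and> (\<forall>x. 0 \<le> \<theta> x) \<and>
    (\<forall>x. norm x \<le> 1 / 2 \<longrightarrow> \<theta> x = 1) \<and> (\<forall>x. 1 \<le> norm x \<longrightarrow> \<theta> x = 0)"
proof -
  define q :: "real^2 \<Rightarrow> real" where "q x = x $ 1 * x $ 1 + x $ 2 * x $ 2" for x
  have q: "q x = norm x ^ 2" for x
    unfolding q_def power2_norm_eq_inner by (simp add: inner_vec_def sum_2)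
  define a where "a x = flat_exp 0 (1 + (- 1) * q x)" for x
  define b where "b x = flat_exp 0 (q x + (- 1 / 4))" for x
  define \<theta> where "\<theta> x = a x * inverse (a x + b x)" for x
  have pos: "0 < a x + b x" for x
  proof (cases "q x < 1")
    case True
    then show ?thesis unfolding a_def b_def
      by (intro add_pos_nonneg[OF flat_exp_pos flat_exp_nonneg]) simp
  next
    case False
    then show ?thesis unfolding a_def b_def
      by (intro add_nonneg_pos[OF flat_exp_nonneg flat_exp_pos]) simp
  qed
  have "Ck_on k UNIV \<theta>" for k
    unfolding \<theta>_def a_def b_def q_def
    using pos[unfolded a_def b_def q_def]
    by (intro Ck_on_mult Ck_on_inverse Ck_on_add Ck_on_flat_exp Ck_on_const Ck_on_coord)
      (auto simp: less_le)
  moreover have "0 \<le> \<theta> x" for x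
    using pos[of x] by (simp add: \<theta>_def a_def flat_exp_nonneg)
  moreover have "\<theta> x = 1" if "norm x \<le> 1 / 2" for x
  proof -
    have "q x \<le> (1 / 2) ^ 2" unfolding q using that by (intro power_mono) auto
    then have "b x = 0" by (simp add: b_def flat_exp_def power2_eq_square)
    then show ?thesis using pos[of x] by (simp add: \<theta>_def)
  qed
  moreover have "\<theta> x = 0" if "1 \<le> norm x" for x
  proof -
    have "1 \<le> q x" unfolding q using that by simp
    then show ?thesis by (simp add: \<theta>_def a_def flat_exp_def)
  qed
  ultimately show ?thesis unfolding smooth_on_def by blast
qed

lemma exists_cutoff:
  assumes "0 < d"
  shows "\<exists>\<eta>. smooth_on UNIV \<eta> \<and> (\<forall>x. 0 \<le> \<eta> x) \<and>
    (\<forall>x\<in>ball c (d / 2). \<eta> x = 1) \<and> (\<forall>x. x \<notin> cball c d \<longrightarrow> \<eta> x = 0)"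
proof -
  obtain \<theta> where \<theta>: "smooth_on UNIV \<theta>" "\<And>x. 0 \<le> \<theta> x"
    "\<And>x. norm x \<le> 1 / 2 \<Longrightarrow> \<theta> x = 1" "\<And>x. 1 \<le> norm x \<Longrightarrow> \<theta> x = 0"
    using exists_cutoff_at_0 by metis
  let ?\<eta> = "\<lambda>x. \<theta> ((1 / d) *\<^sub>R (x - c))"
  have N: "norm ((1 / d) *\<^sub>R (x - c)) = dist c x / d" for x
    using assms by (simp add: dist_norm norm_minus_commute)
  have "smooth_on UNIV ?\<eta>" using smooth_on_affine[OF \<theta>(1)] by simp
  moreover have "?\<eta> x = 1" if "x \<in> ball c (d / 2)" for x
    by (rule \<theta>(3), unfold N) (use that assms in \<open>simp add: field_simps\<close>)
  moreover have "?\<eta> x = 0" if "x \<notin> cball c d" for x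
    by (rule \<theta>(4), unfold N) (use that assms in \<open>simp add: field_simps\<close>)
  ultimately show ?thesis using \<theta>(2) by (intro exI[of _ ?\<eta>]) blast
qed

lemma smooth_on_diff:
  assumes "open U" "smooth_on U f" "smooth_on U g"
  shows "smooth_on U (\<lambda>x. f x - g x)"
  using smooth_on_add[OF assms(1,2) smooth_on_mult[OF assms(1) smooth_on_const[of U "- 1"] assms(3)]]
  by simp

section \<open>Test functions\<close>

lemma test_functionsI:
  assumes "smooth_on UNIV \<phi>" "compact K" "K \<subseteq> U" "\<And>x. x \<notin> K \<Longrightarrow> \<phi> x = 0"
  shows "\<phi> \<in> test_functions U"
proof -
  have "closure {x. \<phi> x \<noteq> 0} \<subseteq> K"
    using assms by (intro closure_minimal) (auto intro: compact_imp_closed)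
  moreover from this have "compact (closure {x. \<phi> x \<noteq> 0})"
    using assms(2) by (metis closed_closure compact_Int_closed inf.absorb_iff2)
  ultimately show ?thesis using assms unfolding test_functions_def by auto
qed

lemma test_functions_smooth: "\<phi> \<in> test_functions U \<Longrightarrow> smooth_on UNIV \<phi>"
  by (simp add: test_functions_def)

lemma test_functionsE:
  assumes "\<phi> \<in> test_functions U"
  obtains K where "compact K" "K \<subseteq> U" "K = closure {x. \<phi> x \<noteq> 0}" "\<And>x. x \<notin> K \<Longrightarrow> \<phi> x = 0"
  using assms closure_subset[of "{x. \<phi> x \<noteq> 0}"] unfolding test_functions_def by blast

lemma test_functions_mono: "\<phi> \<in> test_functions U \<Longrightarrow> U \<subseteq> V \<Longrightarrow> \<phi> \<in> test_functions V"
  by (auto simp: test_functions_def)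

lemma test_functions_zero [simp]: "(\<lambda>x. 0) \<in> test_functions U"
  by (rule test_functionsI[of _ "{}"]) (auto intro: smooth_on_const)

lemma test_functions_add:
  assumes "\<phi> \<in> test_functions U" "\<psi> \<in> test_functions U"
  shows "(\<lambda>x. \<phi> x + \<psi> x) \<in> test_functions U"
proof -
  obtain K where "compact K" "K \<subseteq> U" "\<And>x. x \<notin> K \<Longrightarrow> \<phi> x = 0"
    using test_functionsE[OF assms(1)] by metis
  moreover obtain L where "compact L" "L \<subseteq> U" "\<And>x. x \<notin> L \<Longrightarrow> \<psi> x = 0"
    using test_functionsE[OF assms(2)] by metis
  ultimately show ?thesis using assms
    by (intro test_functionsI[of _ "K \<union> L"])
      (auto intro: smooth_on_add test_functions_smooth)
qed

lemma test_functions_support: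
  assumes "\<phi> \<in> test_functions U" "smooth_on UNIV \<psi>" "\<And>x. \<phi> x = 0 \<Longrightarrow> \<psi> x = 0"
  shows "\<psi> \<in> test_functions U"
proof -
  obtain K where "compact K" "K \<subseteq> U" "\<And>x. x \<notin> K \<Longrightarrow> \<phi> x = 0"
    using test_functionsE[OF assms(1)] by metis
  then show ?thesis using assms by (intro test_functionsI[of _ K]) auto
qed

lemma test_functions_cmult: "\<phi> \<in> test_functions U \<Longrightarrow> (\<lambda>x. c * \<phi> x) \<in> test_functions U"
  by (rule test_functions_support[of \<phi>])
    (auto intro: smooth_on_mult smooth_on_const test_functions_smooth)

lemma test_functions_sum:
  "finite A \<Longrightarrow> (\<And>a. a \<in> A \<Longrightarrow> \<phi> a \<in> test_functions U) \<Longrightarrow> (\<lambda>x. \<Sum>a\<in>A. \<phi> a x) \<in> test_functions U"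
  by (induction A rule: finite_induct) (auto intro: test_functions_add)

text \<open>Multiplying by the test function extends the product smoothly by zero outside \<open>U\<close>,
  whatever values \<open>f\<close> has there.\<close>

lemma test_functions_mult:
  assumes "open U" "smooth_on U f" "\<phi> \<in> test_functions U"
  shows "(\<lambda>x. f x * \<phi> x) \<in> test_functions U"
proof -
  obtain K where K: "compact K" "K \<subseteq> U" "\<And>x. x \<notin> K \<Longrightarrow> \<phi> x = 0"
    using test_functionsE[OF assms(3)] by metis
  have "smooth_on UNIV (\<lambda>x. f x * \<phi> x)"
  proof (rule smooth_on_local)
    fix x
    have "smooth_on U (\<lambda>x. f x * \<phi> x)"
      by (rule smooth_on_mult[OF assms(1,2) smooth_on_subset[OF test_functions_smooth[OF assms(3)] subset_UNIV]])
    moreover have "smooth_on (- K) (\<lambda>x. f x * \<phi> x)"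
      by (rule smooth_on_cong[OF _ _ smooth_on_const[of _ 0]])
        (use K in \<open>auto simp: compact_imp_closed\<close>)
    ultimately show "\<exists>V. open V \<and> x \<in> V \<and> smooth_on V (\<lambda>x. f x * \<phi> x)"
      using assms(1) K by (metis ComplI compact_imp_closed open_Compl subsetD)
  qed
  then show ?thesis using K by (intro test_functionsI[of _ K]) auto
qed

lemma pd_eq_0_outside:
  assumes "compact K" "\<And>x. x \<notin> K \<Longrightarrow> \<phi> x = 0" "x \<notin> K"
  shows "pd j \<phi> x = 0"
  using pd_cong_open[of "- K" x \<phi> "\<lambda>x. 0" j] assms open_Compl[OF compact_imp_closed[OF assms(1)]] by auto

lemma pd_closure_support:
  assumes "\<phi> \<in> test_functions U" "closure {x. \<phi> x \<noteq> 0} \<subseteq> K" "compact K"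
  shows "closure {x. pd j \<phi> x \<noteq> 0} \<subseteq> K"
proof (rule closure_minimal)
  have "\<phi> x = 0" if "x \<notin> K" for x
    using that assms(2) closure_subset[of "{x. \<phi> x \<noteq> 0}"] by blast
  then show "{x. pd j \<phi> x \<noteq> 0} \<subseteq> K" using pd_eq_0_outside[OF assms(3)] by blast
qed (use assms in \<open>auto intro: compact_imp_closed\<close>)

lemma test_functions_pd:
  assumes "\<phi> \<in> test_functions U"
  shows "pd j \<phi> \<in> test_functions U"
proof -
  obtain K where K: "compact K" "K \<subseteq> U" "\<And>x. x \<notin> K \<Longrightarrow> \<phi> x = 0"
    using test_functionsE[OF assms] by metis
  then show ?thesis using assms
    by (intro test_functionsI[of _ K] pd_eq_0_outside[OF K(1,3)])
      (auto intro: smooth_on_pd test_functions_smooth)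
qed

lemma test_functions_bounded:
  assumes "\<phi> \<in> test_functions U"
  shows "\<exists>M\<ge>0. \<forall>x. \<bar>\<phi> x\<bar> \<le> M"
proof -
  obtain K where K: "compact K" "\<And>x. x \<notin> K \<Longrightarrow> \<phi> x = 0"
    using test_functionsE[OF assms] by metis
  have "compact (\<phi> ` K)"
    using K(1) smooth_on_continuous[OF test_functions_smooth[OF assms]]
    by (intro compact_continuous_image) (auto intro: continuous_on_subset)
  then obtain M where "\<forall>y\<in>\<phi> ` K. norm y \<le> M"
    using compact_imp_bounded bounded_iff by blast
  then have M: "\<bar>\<phi> x\<bar> \<le> M" if "x \<in> K" for x
    using that by simp
  have "\<bar>\<phi> x\<bar> \<le> max M 0" for x
    using M[of x] K(2)[of x] by (cases "x \<in> K") auto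
  then show ?thesis by (intro exI[of _ "max M 0"]) auto
qed

section \<open>Integration against test functions\<close>

lemma integrable_continuous_mult_test:
  assumes "continuous_on U f" "\<phi> \<in> test_functions U"
  shows "integrable lborel (\<lambda>x. f x * \<phi> x)"
proof -
  obtain K where K: "compact K" "K \<subseteq> U" "\<And>x. x \<notin> K \<Longrightarrow> \<phi> x = 0"
    using test_functionsE[OF assms(2)] by metis
  have "continuous_on K (\<lambda>x. f x * \<phi> x)"
    using assms K smooth_on_continuous[OF test_functions_smooth[OF assms(2)]]
    by (intro continuous_intros) (auto intro: continuous_on_subset)
  from borel_integrable_compact[OF K(1) this]
  have "integrable lborel (\<lambda>x. indicator K x *\<^sub>R (f x * \<phi> x))" .
  moreover have "(\<lambda>x. indicator K x *\<^sub>R (f x * \<phi> x)) = (\<lambda>x. f x * \<phi> x)"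
    using K(3) by (auto simp: indicator_def fun_eq_iff)
  ultimately show ?thesis by metis
qed

lemma integrable_test: "\<phi> \<in> test_functions U \<Longrightarrow> integrable lborel \<phi>"
  using integrable_continuous_mult_test[OF continuous_on_const[of U "1::real"]] by simp

text \<open>The integral is invariant under translation, so the integrals of the difference quotients
  vanish; by dominated convergence so does that of the derivative.\<close>

lemma integral_pd_test:
  assumes "\<phi> \<in> test_functions U"
  shows "(LINT x|lborel. pd j \<phi> x) = 0"
proof -
  have sm: "smooth_on UNIV \<phi>" using assms by (rule test_functions_smooth)
  have meas: "\<phi> \<in> borel_measurable borel" "pd j \<phi> \<in> borel_measurable borel"
    using sm by (auto intro!: borel_measurable_continuous_onI smooth_on_continuous smooth_on_pd)
  define h where "h n = 1 / real (Suc n)" for n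
  have h0: "h \<longlonglongrightarrow> 0" unfolding h_def by (rule lim_1_over_n[THEN LIMSEQ_Suc])
  have h: "0 < h n" "h n \<le> 1" for n unfolding h_def by simp_all
  define Q where "Q n x = (\<phi> (h n *\<^sub>R axis j 1 + x) - \<phi> x) / h n" for n x
  have Q: "\<exists>\<xi>. dist \<xi> x \<le> h n \<and> Q n x = pd j \<phi> \<xi>" for n x
  proof -
    have sum: "(\<Sum>k\<in>UNIV. (h n *\<^sub>R axis j (1::real)) $ k * p k) = h n * p j" for p
      using sum_axis[of j p] by (simp add: mult.assoc flip: sum_distrib_left)
    obtain t where t: "t \<in> {0<..<1}"
      "\<phi> (x + h n *\<^sub>R axis j 1) - \<phi> x = h n * pd j \<phi> (x + t *\<^sub>R h n *\<^sub>R axis j 1)"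
      using mean_value_pd[of \<phi> x "h n *\<^sub>R axis j 1"] smooth_on_differentiable[OF sm]
      unfolding sum by auto
    have "dist (x + t *\<^sub>R h n *\<^sub>R axis j 1) x = t * h n"
      using t(1) h(1)[of n] by (simp add: dist_norm abs_mult)
    also have "\<dots> \<le> 1 * h n" using t(1) h(1)[of n] by (intro mult_right_mono) auto
    finally have "dist (x + t *\<^sub>R h n *\<^sub>R axis j 1) x \<le> h n" by simp
    moreover have "Q n x = pd j \<phi> (x + t *\<^sub>R h n *\<^sub>R axis j 1)"
      unfolding Q_def using t(2) h(1)[of n] by (simp add: add.commute)
    ultimately show ?thesis by blast
  qed
  have conv: "(\<lambda>n. Q n x) \<longlonglongrightarrow> pd j \<phi> x" for x
  proof -
    obtain \<xi> where \<xi>: "\<And>n. dist (\<xi> n) x \<le> h n" "\<And>n. Q n x = pd j \<phi> (\<xi> n)"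
      using Q by metis
    have "(\<lambda>n. dist (\<xi> n) x) \<longlonglongrightarrow> 0"
      by (rule tendsto_sandwich[OF _ _ tendsto_const h0]) (simp_all add: \<xi>(1))
    then have "\<xi> \<longlonglongrightarrow> x" by (rule tendsto_dist_iff[THEN iffD2])
    moreover have "isCont (pd j \<phi>) x"
      using smooth_on_continuous[OF smooth_on_pd[OF sm]] by (simp add: continuous_on_eq_continuous_at)
    ultimately have "(\<lambda>n. pd j \<phi> (\<xi> n)) \<longlonglongrightarrow> pd j \<phi> x"
      by (metis isCont_tendsto_compose)
    then show ?thesis using \<xi>(2) by simp
  qed
  obtain K where K: "compact K" "\<And>x. x \<notin> K \<Longrightarrow> \<phi> x = 0"
    using test_functionsE[OF assms] by metis
  obtain R where R: "\<And>x. x \<in> K \<Longrightarrow> norm x \<le> R"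
    using compact_imp_bounded[OF K(1)] by (auto simp: bounded_iff)
  obtain M where M: "0 \<le> M" "\<And>x. \<bar>pd j \<phi> x\<bar> \<le> M"
    using test_functions_bounded[OF test_functions_pd[OF assms]] by metis
  have bound: "\<bar>Q n x\<bar> \<le> indicator (cball 0 (R + 1)) x *\<^sub>R M" for n x
  proof (cases "x \<in> cball 0 (R + 1)")
    case True
    obtain \<xi> where "Q n x = pd j \<phi> \<xi>" using Q by blast
    with True show ?thesis by (simp add: M)
  next
    case False
    obtain \<xi> where \<xi>: "dist \<xi> x \<le> h n" "Q n x = pd j \<phi> \<xi>" using Q by blast
    have "norm x \<le> dist \<xi> x + norm \<xi>"
      by (metis dist_commute dist_0_norm dist_triangle add.commute)
    with False \<xi>(1) h(2)[of n] have "R < norm \<xi>" by simp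
    then have "pd j \<phi> \<xi> = 0" using pd_eq_0_outside[OF K] R by (meson not_less)
    with \<xi>(2) show ?thesis by (simp add: M)
  qed
  have trans: "(LINT x|lborel. \<phi> (h n *\<^sub>R axis j 1 + x)) = (LINT x|lborel. \<phi> x)" for n
    using integral_distr[of "(+) (h n *\<^sub>R axis j 1)" lborel borel \<phi>] meas
    by (simp add: lborel_distr_plus)
  have transi: "integrable lborel (\<lambda>x. \<phi> (h n *\<^sub>R axis j 1 + x))" for n
    using integrable_distr_eq[of "(+) (h n *\<^sub>R axis j 1)" lborel borel \<phi>] meas integrable_test[OF assms]
    by (simp add: lborel_distr_plus)
  have "(LINT x|lborel. Q n x) = 0" for n
    unfolding Q_def using trans[of n] transi[of n] integrable_test[OF assms] by simp
  moreover have "(\<lambda>n. LINT x|lborel. Q n x) \<longlonglongrightarrow> (LINT x|lborel. pd j \<phi> x)"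
  proof (rule integral_dominated_convergence)
    show "integrable lborel (\<lambda>x::real^2. indicator (cball 0 (R + 1)) x *\<^sub>R M)"
      by (intro borel_integrable_compact) auto
    show "Q n \<in> borel_measurable lborel" for n
      unfolding Q_def using meas by measurable
  qed (use meas conv bound in auto)
  ultimately show ?thesis using LIMSEQ_unique[OF _ tendsto_const] by fastforce
qed

lemma integral_by_parts:
  assumes "open U" "smooth_on U f" "\<phi> \<in> test_functions U"
  shows "(LINT x|lborel. f x * pd j \<phi> x) = - (LINT x|lborel. pd j f x * \<phi> x)"
proof -
  obtain K where K: "compact K" "K \<subseteq> U" "\<And>x. x \<notin> K \<Longrightarrow> \<phi> x = 0"
    using test_functionsE[OF assms(3)] by metis
  have eq: "pd j (\<lambda>x. f x * \<phi> x) x = pd j f x * \<phi> x + f x * pd j \<phi> x" for x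
  proof (cases "x \<in> K")
    case True
    then show ?thesis using assms K
      by (intro pd_mult) (auto intro: smooth_on_differentiable test_functions_smooth)
  next
    case False
    then show ?thesis
      using pd_eq_0_outside[OF K(1), of "\<lambda>x. f x * \<phi> x"] pd_eq_0_outside[OF K(1,3)] K(3) by simp
  qed
  have "0 = (LINT x|lborel. pd j f x * \<phi> x + f x * pd j \<phi> x)"
    using integral_pd_test[OF test_functions_mult[OF assms], of j] unfolding eq by simp
  also have "\<dots> = (LINT x|lborel. pd j f x * \<phi> x) + (LINT x|lborel. f x * pd j \<phi> x)"
    using assms by (intro Bochner_Integration.integral_add integrable_continuous_mult_test[of U])
      (auto intro: smooth_on_continuous smooth_on_pd test_functions_pd)
  finally show ?thesis by simp
qed

text \<open>Near a point where \<open>f\<close> is not \<open>0\<close> it has constant sign, and a nonnegative cutoff function supported there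
  has an integral against \<open>f\<close> of that sign. The factor \<open>s\<close> in the proof is the sign.\<close>

lemma fundamental_lemma:
  assumes U: "open U" and f: "continuous_on U f"
    and z: "\<And>\<phi>. \<phi> \<in> test_functions U \<Longrightarrow> (LINT x|lborel. f x * \<phi> x) = 0"
    and "a \<in> U"
  shows "f a = 0"
proof (rule ccontr)
  assume "f a \<noteq> 0"
  define s where "s = sgn (f a)"
  define c where "c = \<bar>f a\<bar> / 2"
  have c: "0 < c" "c < s * f a" using \<open>f a \<noteq> 0\<close> by (auto simp: c_def s_def sgn_if)
  have "isCont (\<lambda>x. s * f x) a"
    using f U \<open>a \<in> U\<close> by (intro continuous_intros) (auto simp: continuous_on_eq_continuous_at)
  then have "\<forall>\<^sub>F x in at a. c < s * f x"
    using c(2) by (intro order_tendstoD(1)) (auto simp: isCont_def)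
  then obtain d1 where d1: "0 < d1" "\<And>x. x \<noteq> a \<Longrightarrow> dist x a < d1 \<Longrightarrow> c < s * f x"
    unfolding eventually_at by auto
  obtain d2 where d2: "0 < d2" "cball a d2 \<subseteq> U"
    using U \<open>a \<in> U\<close> open_contains_cball by blast
  define d where "d = min d2 (d1 / 2)"
  have d: "0 < d" "cball a d \<subseteq> U" "\<And>x. x \<in> cball a d \<Longrightarrow> c \<le> s * f x"
  proof -
    show "0 < d" "cball a d \<subseteq> U" using d1 d2 by (auto simp: d_def)
    show "c \<le> s * f x" if "x \<in> cball a d" for x
      using that d1(1) d1(2)[of x] c(2) by (cases "x = a") (auto simp: d_def dist_commute)
  qed
  obtain \<eta> where \<eta>: "smooth_on UNIV \<eta>" "\<And>x. 0 \<le> \<eta> x"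
    "\<And>x. x \<in> ball a (d / 2) \<Longrightarrow> \<eta> x = 1" "\<And>x. x \<notin> cball a d \<Longrightarrow> \<eta> x = 0"
    using exists_cutoff[OF d(1), of a] by metis
  have t: "\<eta> \<in> test_functions U"
    using \<eta> d by (intro test_functionsI[of _ "cball a d"]) auto
  let ?B = "ball a (d / 2)"
  have le: "c * indicator ?B x \<le> s * (f x * \<eta> x)" for x
  proof (cases "x \<in> cball a d")
    case True
    have "c * indicator ?B x \<le> c * \<eta> x"
      using c(1) \<eta>(2)[of x] \<eta>(3)[of x] by (cases "x \<in> ?B") auto
    also have "\<dots> \<le> (s * f x) * \<eta> x" by (intro mult_right_mono d(3) True \<eta>(2))
    finally show ?thesis by (simp add: mult.assoc)
  next
    case False
    moreover from this have "x \<notin> ?B" using d(1) by auto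
    ultimately show ?thesis using \<eta>(4)[of x] by simp
  qed
  have fin: "emeasure lborel ?B < \<infinity>"
    by (rule emeasure_bounded_finite) simp
  have "c * measure lborel ?B = (LINT x|lborel. c * indicator ?B x)"
    by simp
  also have "\<dots> \<le> (LINT x|lborel. s * (f x * \<eta> x))"
    using fin integrable_continuous_mult_test[OF f t] le
    by (intro integral_mono) (auto simp: integrable_indicator_iff)
  also have "\<dots> = 0" using z[OF t] by simp
  finally have "c * measure lborel ?B \<le> 0" .
  moreover have "0 < measure lborel ?B" using d(1) by (intro content_ball_pos) simp
  ultimately show False using c(1) by (simp add: mult_le_0_iff)
qed

section \<open>Local smooth representatives glue\<close>

definition test_linear :: "(real^2) set \<Rightarrow> functional \<Rightarrow> bool"
  where "test_linear U T \<longleftrightarrow>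
    (\<forall>\<phi>\<in>test_functions U. \<forall>\<psi>\<in>test_functions U. T (\<lambda>x. \<phi> x + \<psi> x) = T \<phi> + T \<psi>) \<and>
    (\<forall>c. \<forall>\<phi>\<in>test_functions U. T (\<lambda>x. c * \<phi> x) = c * T \<phi>)"

lemma test_linear_add:
  "test_linear U T \<Longrightarrow> \<phi> \<in> test_functions U \<Longrightarrow> \<psi> \<in> test_functions U \<Longrightarrow>
    T (\<lambda>x. \<phi> x + \<psi> x) = T \<phi> + T \<psi>"
  by (simp add: test_linear_def)

lemma test_linear_cmult:
  "test_linear U T \<Longrightarrow> \<phi> \<in> test_functions U \<Longrightarrow> T (\<lambda>x. c * \<phi> x) = c * T \<phi>"
  by (simp add: test_linear_def)

lemma test_linear_zero: "test_linear U T \<Longrightarrow> T (\<lambda>x. 0) = 0"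
  using test_linear_cmult[of U T "\<lambda>x. 0" 0] by simp

lemma test_linear_sum:
  assumes "test_linear U T"
  shows "finite A \<Longrightarrow> (\<And>a. a \<in> A \<Longrightarrow> \<phi> a \<in> test_functions U) \<Longrightarrow>
    T (\<lambda>x. \<Sum>a\<in>A. \<phi> a x) = (\<Sum>a\<in>A. T (\<phi> a))"
proof (induction A rule: finite_induct)
  case (insert a A)
  then show ?case
    using test_linear_add[OF assms, of "\<phi> a" "\<lambda>x. \<Sum>a\<in>A. \<phi> a x"] by (simp add: test_functions_sum)
qed (simp add: test_linear_zero[OF assms])

lemma given_by_subset: "given_by U T f \<Longrightarrow> V \<subseteq> U \<Longrightarrow> given_by V T f"
  unfolding given_by_def by (meson smooth_on_subset test_functions_mono)

lemma given_by_unique: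
  assumes "open U" "given_by U T f" "given_by U T g" "x \<in> U"
  shows "f x = g x"
proof -
  have c: "continuous_on U f" "continuous_on U g"
    using assms smooth_on_continuous unfolding given_by_def by blast+
  have "(LINT x|lborel. (f x - g x) * \<phi> x) = 0" if "\<phi> \<in> test_functions U" for \<phi>
  proof -
    have "(LINT x|lborel. (f x - g x) * \<phi> x) = (LINT x|lborel. f x * \<phi> x) - (LINT x|lborel. g x * \<phi> x)"
      using integrable_continuous_mult_test[OF c(1) that] integrable_continuous_mult_test[OF c(2) that]
      by (simp add: left_diff_distrib)
    then show ?thesis using assms that unfolding given_by_def by simp
  qed
  from fundamental_lemma[OF assms(1) _ this assms(4)] c show ?thesis
    by (auto intro: continuous_intros)
qed

text \<open>By uniqueness the local representatives agree on overlaps and define one smooth function.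
  To see that it represents the functional, the support of a test function is covered by finitely
  many balls, and one ball at a time is split off with a cutoff function.\<close>

lemma given_by_local:
  assumes U: "open U" and T: "test_linear U T"
    and loc: "\<And>x. x \<in> U \<Longrightarrow> \<exists>V f. open V \<and> x \<in> V \<and> V \<subseteq> U \<and> given_by V T f"
  shows "\<exists>f. given_by U T f"
proof -
  obtain V F where V: "\<And>x. x \<in> U \<Longrightarrow> open (V x)" "\<And>x. x \<in> U \<Longrightarrow> x \<in> V x"
    "\<And>x. x \<in> U \<Longrightarrow> V x \<subseteq> U" "\<And>x. x \<in> U \<Longrightarrow> given_by (V x) T (F x)"
    using loc by metis
  define f where "f x = F x x" for x
  have f: "F x y = f y" if "x \<in> U" "y \<in> V x" for x y
  proof -
    have y: "y \<in> U" using that V by blast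
    have "given_by (V x \<inter> V y) T (F x)" "given_by (V x \<inter> V y) T (F y)"
      using V(4)[OF that(1)] V(4)[OF y] given_by_subset by blast+
    then have "F x y = F y y"
      using given_by_unique[of "V x \<inter> V y" T "F x" "F y" y] V that y by blast
    then show ?thesis by (simp add: f_def)
  qed
  have smooth: "smooth_on U f"
  proof (rule smooth_on_local)
    fix x assume x: "x \<in> U"
    have "smooth_on (V x) f"
      using smooth_on_cong[of "V x" "F x" f] V(1)[OF x] f[OF x] V(4)[OF x]
      unfolding given_by_def by blast
    then show "\<exists>V. open V \<and> x \<in> V \<and> smooth_on V f" using V x by blast
  qed
  have rep: "T \<phi> = (LINT y|lborel. f y * \<phi> y)" if "x \<in> U" "\<phi> \<in> test_functions (V x)" for x \<phi>
  proof -
    have "F x y * \<phi> y = f y * \<phi> y" for y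
      using f[OF that(1), of y] test_functionsE[OF that(2)] by (metis mult_zero_right subsetD)
    then have "(\<lambda>y. F x y * \<phi> y) = (\<lambda>y. f y * \<phi> y)" by blast
    then show ?thesis using V(4)[OF that(1)] that(2) unfolding given_by_def by simp
  qed
  have "\<exists>d. 0 < d \<and> cball x d \<subseteq> V x" if "x \<in> U" for x
    using V[OF that] open_contains_cball by blast
  then obtain d where d: "\<And>x. x \<in> U \<Longrightarrow> 0 < d x" "\<And>x. x \<in> U \<Longrightarrow> cball x (d x) \<subseteq> V x"
    by metis
  have glue: "T \<phi> = (LINT y|lborel. f y * \<phi> y)"
    if "finite C" "C \<subseteq> U" "\<phi> \<in> test_functions U" "closure {y. \<phi> y \<noteq> 0} \<subseteq> (\<Union>x\<in>C. ball x (d x / 2))" for C \<phi>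
    using that
  proof (induction C arbitrary: \<phi> rule: finite_induct)
    case empty
    then have "\<phi> = (\<lambda>y. 0)" using closure_subset[of "{y. \<phi> y \<noteq> 0}"] by auto
    then show ?case using test_linear_zero[OF T] by simp
  next
    case (insert x C)
    then have x: "x \<in> U" by simp
    obtain K where K: "compact K" "K \<subseteq> U" "K = closure {y. \<phi> y \<noteq> 0}" "\<And>y. y \<notin> K \<Longrightarrow> \<phi> y = 0"
      using test_functionsE[OF insert.prems(2)] by metis
    obtain \<eta> where \<eta>: "smooth_on UNIV \<eta>"
      "\<And>y. y \<in> ball x (d x / 2) \<Longrightarrow> \<eta> y = 1" "\<And>y. y \<notin> cball x (d x) \<Longrightarrow> \<eta> y = 0"
      using exists_cutoff[OF d(1)[OF x], of x] by metis
    define \<phi>1 where "\<phi>1 y = \<eta> y * \<phi> y" for y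
    define \<phi>2 where "\<phi>2 y = (1 - \<eta> y) * \<phi> y" for y
    have split: "\<phi> = (\<lambda>y. \<phi>1 y + \<phi>2 y)" by (auto simp: \<phi>1_def \<phi>2_def algebra_simps)
    have sm: "smooth_on UNIV \<phi>1" "smooth_on UNIV \<phi>2"
      unfolding \<phi>1_def \<phi>2_def using \<eta>(1) test_functions_smooth[OF insert.prems(2)]
      by (auto intro!: smooth_on_mult smooth_on_diff smooth_on_const)
    have t1: "\<phi>1 \<in> test_functions (V x)"
      using sm \<eta>(3) d(2)[OF x]
      by (intro test_functionsI[of _ "cball x (d x)"]) (auto simp: \<phi>1_def)
    have K2: "compact (K - ball x (d x / 2))" using K(1) by (intro compact_diff) auto
    have z2: "\<phi>2 y = 0" if "y \<notin> K - ball x (d x / 2)" for y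
      using that K(4)[of y] \<eta>(2)[of y] by (auto simp: \<phi>2_def)
    have t2: "\<phi>2 \<in> test_functions U"
      using sm K2 K(2) z2 by (intro test_functionsI[of _ "K - ball x (d x / 2)"]) auto
    have "closure {y. \<phi>2 y \<noteq> 0} \<subseteq> K - ball x (d x / 2)"
      using z2 K2 by (intro closure_minimal) (auto intro: compact_imp_closed)
    also have "\<dots> \<subseteq> (\<Union>x\<in>C. ball x (d x / 2))" using insert.prems(3) K(3) by auto
    finally have T2: "T \<phi>2 = (LINT y|lborel. f y * \<phi>2 y)"
      using insert.prems t2 by (intro insert.IH) auto
    have T1: "T \<phi>1 = (LINT y|lborel. f y * \<phi>1 y)" by (rule rep[OF x t1])
    have t1': "\<phi>1 \<in> test_functions U" using t1 V(3)[OF x] by (rule test_functions_mono)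
    have cf: "continuous_on U f" using smooth by (rule smooth_on_continuous)
    have "T \<phi> = T \<phi>1 + T \<phi>2"
      using test_linear_add[OF T t1' t2] split by simp
    also have "\<dots> = (LINT y|lborel. f y * \<phi>1 y + f y * \<phi>2 y)"
      unfolding T1 T2 using integrable_continuous_mult_test[OF cf] t1' t2
      by (intro Bochner_Integration.integral_add[symmetric]) auto
    also have "\<dots> = (LINT y|lborel. f y * \<phi> y)"
      by (simp add: \<phi>1_def \<phi>2_def algebra_simps)
    finally show ?case .
  qed
  have "T \<phi> = (LINT y|lborel. f y * \<phi> y)" if t: "\<phi> \<in> test_functions U" for \<phi>
  proof -
    obtain K where K: "compact K" "K \<subseteq> U" "K = closure {y. \<phi> y \<noteq> 0}"
      using test_functionsE[OF t] by metis
    have "K \<subseteq> (\<Union>x\<in>K. ball x (d x / 2))" using K(2) d(1) by force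
    then obtain C where "C \<subseteq> K" "finite C" "K \<subseteq> (\<Union>x\<in>C. ball x (d x / 2))"
      using compactE_image[OF K(1), of K "\<lambda>x. ball x (d x / 2)"] by auto
    then show ?thesis using K t by (intro glue[of C]) auto
  qed
  then show ?thesis using smooth unfolding given_by_def by blast
qed

lemma A_scalar_test_linear: "T \<in> A_scalar \<Omega> \<Longrightarrow> test_linear \<Omega> T"
  by (simp add: A_scalar_def distributions_def test_linear_def)

lemma test_linear_subset: "test_linear U T \<Longrightarrow> V \<subseteq> U \<Longrightarrow> test_linear V T"
  unfolding test_linear_def by (meson test_functions_mono)

lemma given_by_smooth_rep:
  assumes "open \<Omega>" "T \<in> A_scalar \<Omega>"
  shows "given_by (\<Omega> - {0}) T (smooth_rep (\<Omega> - {0}) T)"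
proof -
  have "\<exists>V f. open V \<and> x \<in> V \<and> V \<subseteq> \<Omega> - {0} \<and> given_by V T f" if x: "x \<in> \<Omega> - {0}" for x
  proof -
    have "x \<notin> singular_support \<Omega> T" using assms(2) x by (auto simp: A_scalar_def)
    then obtain V f where V: "open V" "x \<in> V" "V \<subseteq> \<Omega>" "given_by V T f"
      using x by (auto simp: singular_support_def)
    then have "open (V - {0})" "x \<in> V - {0}" "V - {0} \<subseteq> \<Omega> - {0}" "given_by (V - {0}) T f"
      using x given_by_subset[of V T f "V - {0}"] by auto
    then show ?thesis by blast
  qed
  then have "\<exists>f. given_by (\<Omega> - {0}) T f"
    using assms A_scalar_test_linear[OF assms(2)]
    by (intro given_by_local) (auto intro: test_linear_subset)
  then show ?thesis unfolding smooth_rep_def by (rule someI_ex)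
qed

section \<open>Functionals concentrated at the origin\<close>

lemma finite_mi_order_le: "finite {\<alpha>. mi_order \<alpha> \<le> N}"
proof (rule finite_imageD)
  show "finite ((\<lambda>\<alpha>. (\<alpha> $ 1, \<alpha> $ 2)) ` {\<alpha>. mi_order \<alpha> \<le> N})"
    by (rule finite_subset[of _ "{..N} \<times> {..N}"]) (auto simp: mi_order_def)
  show "inj_on (\<lambda>\<alpha>::multi_index. (\<alpha> $ 1, \<alpha> $ 2)) {\<alpha>. mi_order \<alpha> \<le> N}"
    by (auto simp: inj_on_def vec_eq_iff forall_2)
qed

text \<open>The seminorm estimates of a distribution, with the sum of suprema replaced by one common bound
  on all derivatives up to a given order. In this form they pass to \<open>\<lambda>\<phi>. T (pd j \<phi>)\<close> by
  raising the order by one.\<close>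

definition locally_finite_order :: "(real^2) set \<Rightarrow> functional \<Rightarrow> bool"
  where "locally_finite_order U T \<longleftrightarrow> (\<forall>K. compact K \<longrightarrow> K \<subseteq> U \<longrightarrow>
    (\<exists>C\<ge>0. \<exists>N. \<forall>\<phi>\<in>test_functions U. closure {x. \<phi> x \<noteq> 0} \<subseteq> K \<longrightarrow>
      (\<forall>M. (\<forall>u x. length u \<le> N \<longrightarrow> \<bar>fold pd u \<phi> x\<bar> \<le> M) \<longrightarrow> \<bar>T \<phi>\<bar> \<le> C * M)))"

lemma locally_finite_orderE:
  assumes "locally_finite_order U T" "compact K" "K \<subseteq> U"
  obtains C N where "0 \<le> C" "\<And>\<phi> M. \<phi> \<in> test_functions U \<Longrightarrow> closure {x. \<phi> x \<noteq> 0} \<subseteq> K \<Longrightarrow>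
    (\<And>u x. length u \<le> N \<Longrightarrow> \<bar>fold pd u \<phi> x\<bar> \<le> M) \<Longrightarrow> \<bar>T \<phi>\<bar> \<le> C * M"
  using assms unfolding locally_finite_order_def by metis

lemma distributions_locally_finite_order:
  assumes "T \<in> distributions U"
  shows "locally_finite_order U T"
  unfolding locally_finite_order_def
proof (intro allI impI)
  fix K assume K: "compact K" "K \<subseteq> U"
  have "\<forall>K. compact K \<longrightarrow> K \<subseteq> U \<longrightarrow> (\<exists>C N. \<forall>\<phi>\<in>test_functions U. closure {x. \<phi> x \<noteq> 0} \<subseteq> K \<longrightarrow>
      \<bar>T \<phi>\<bar> \<le> C * (\<Sum>\<alpha> | mi_order \<alpha> \<le> N. SUP x. \<bar>mi_deriv \<alpha> \<phi> x\<bar>))"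
    using assms unfolding distributions_def mem_Collect_eq by (elim conjE)
  from this[rule_format, OF K]
  obtain C N where "\<forall>\<phi>\<in>test_functions U. closure {x. \<phi> x \<noteq> 0} \<subseteq> K \<longrightarrow>
      \<bar>T \<phi>\<bar> \<le> C * (\<Sum>\<alpha> | mi_order \<alpha> \<le> N. SUP x. \<bar>mi_deriv \<alpha> \<phi> x\<bar>)"
    by (elim exE)
  note CN = this[rule_format]
  let ?A = "{\<alpha>. mi_order \<alpha> \<le> N}"
  have "\<bar>T \<phi>\<bar> \<le> (\<bar>C\<bar> * card ?A) * M"
    if \<phi>: "\<phi> \<in> test_functions U" "closure {x. \<phi> x \<noteq> 0} \<subseteq> K"
      and M: "\<And>u x. length u \<le> N \<Longrightarrow> \<bar>fold pd u \<phi> x\<bar> \<le> M" for \<phi> M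
  proof -
    let ?S = "\<Sum>\<alpha> | mi_order \<alpha> \<le> N. SUP x. \<bar>mi_deriv \<alpha> \<phi> x\<bar>"
    have le: "\<bar>mi_deriv \<alpha> \<phi> x\<bar> \<le> M" if "\<alpha> \<in> ?A" for \<alpha> x
      unfolding mi_deriv_fold by (rule M) (use that in \<open>simp add: mi_order_def\<close>)
    have "(SUP x. \<bar>mi_deriv \<alpha> \<phi> x\<bar>) \<le> M" if "\<alpha> \<in> ?A" for \<alpha>
      by (rule cSUP_least) (use le[OF that] in auto)
    then have "?S \<le> card ?A * M" using sum_bounded_above[of ?A] by metis
    moreover have "0 \<le> (SUP x. \<bar>mi_deriv \<alpha> \<phi> x\<bar>)" if "\<alpha> \<in> ?A" for \<alpha>
    proof -
      have "bdd_above (range (\<lambda>x. \<bar>mi_deriv \<alpha> \<phi> x\<bar>))"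
        using le[OF that] by (intro bdd_aboveI[of _ M]) auto
      from cSUP_upper[OF UNIV_I this, of 0] show ?thesis by linarith
    qed
    then have "0 \<le> ?S" by (intro sum_nonneg) simp
    ultimately have "C * ?S \<le> \<bar>C\<bar> * (card ?A * M)"
      by (intro mult_mono) auto
    with CN[OF \<phi>] show ?thesis by simp
  qed
  then show "\<exists>C\<ge>0. \<exists>N. \<forall>\<phi>\<in>test_functions U. closure {x. \<phi> x \<noteq> 0} \<subseteq> K \<longrightarrow>
      (\<forall>M. (\<forall>u x. length u \<le> N \<longrightarrow> \<bar>fold pd u \<phi> x\<bar> \<le> M) \<longrightarrow> \<bar>T \<phi>\<bar> \<le> C * M)"
    by (intro exI[of _ "\<bar>C\<bar> * card ?A"] conjI exI[of _ N]) auto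
qed

lemma locally_finite_order_add:
  assumes "locally_finite_order U S" "locally_finite_order U T"
  shows "locally_finite_order U (\<lambda>\<phi>. S \<phi> + T \<phi>)"
  unfolding locally_finite_order_def
proof (intro allI impI)
  fix K assume K: "compact K" "K \<subseteq> U"
  obtain C N where CN: "0 \<le> C" "\<And>\<phi> M. \<phi> \<in> test_functions U \<Longrightarrow> closure {x. \<phi> x \<noteq> 0} \<subseteq> K \<Longrightarrow>
      (\<And>u x. length u \<le> N \<Longrightarrow> \<bar>fold pd u \<phi> x\<bar> \<le> M) \<Longrightarrow> \<bar>S \<phi>\<bar> \<le> C * M"
    using locally_finite_orderE[OF assms(1) K] by metis
  obtain D L where DL: "0 \<le> D" "\<And>\<phi> M. \<phi> \<in> test_functions U \<Longrightarrow> closure {x. \<phi> x \<noteq> 0} \<subseteq> K \<Longrightarrow>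
      (\<And>u x. length u \<le> L \<Longrightarrow> \<bar>fold pd u \<phi> x\<bar> \<le> M) \<Longrightarrow> \<bar>T \<phi>\<bar> \<le> D * M"
    using locally_finite_orderE[OF assms(2) K] by metis
  have "\<bar>S \<phi> + T \<phi>\<bar> \<le> (C + D) * M"
    if \<phi>: "\<phi> \<in> test_functions U" "closure {x. \<phi> x \<noteq> 0} \<subseteq> K"
      and M: "\<And>u x. length u \<le> max N L \<Longrightarrow> \<bar>fold pd u \<phi> x\<bar> \<le> M" for \<phi> M
  proof -
    have "\<bar>S \<phi>\<bar> \<le> C * M" "\<bar>T \<phi>\<bar> \<le> D * M" using M by (auto intro!: CN(2) DL(2) \<phi>)
    then show ?thesis by (simp add: distrib_right)
  qed
  then show "\<exists>C\<ge>0. \<exists>N. \<forall>\<phi>\<in>test_functions U. closure {x. \<phi> x \<noteq> 0} \<subseteq> K \<longrightarrow>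
      (\<forall>M. (\<forall>u x. length u \<le> N \<longrightarrow> \<bar>fold pd u \<phi> x\<bar> \<le> M) \<longrightarrow> \<bar>S \<phi> + T \<phi>\<bar> \<le> C * M)"
    using CN(1) DL(1) by (intro exI[of _ "C + D"] conjI exI[of _ "max N L"]) auto
qed

lemma locally_finite_order_minus_pd:
  assumes "locally_finite_order U T"
  shows "locally_finite_order U (\<lambda>\<phi>. - T (pd j \<phi>))"
  unfolding locally_finite_order_def
proof (intro allI impI)
  fix K assume K: "compact K" "K \<subseteq> U"
  obtain C N where CN: "0 \<le> C" "\<And>\<phi> M. \<phi> \<in> test_functions U \<Longrightarrow> closure {x. \<phi> x \<noteq> 0} \<subseteq> K \<Longrightarrow>
      (\<And>u x. length u \<le> N \<Longrightarrow> \<bar>fold pd u \<phi> x\<bar> \<le> M) \<Longrightarrow> \<bar>T \<phi>\<bar> \<le> C * M"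
    using locally_finite_orderE[OF assms K] by metis
  have "\<bar>- T (pd j \<phi>)\<bar> \<le> C * M"
    if \<phi>: "\<phi> \<in> test_functions U" "closure {x. \<phi> x \<noteq> 0} \<subseteq> K"
      and M: "\<And>u x. length u \<le> Suc N \<Longrightarrow> \<bar>fold pd u \<phi> x\<bar> \<le> M" for \<phi> M
  proof -
    have "\<bar>fold pd u (pd j \<phi>) x\<bar> \<le> M" if "length u \<le> N" for u x
      using M[of "j # u" x] that by simp
    then have "\<bar>T (pd j \<phi>)\<bar> \<le> C * M"
      by (intro CN(2) test_functions_pd pd_closure_support[OF \<phi> K(1)] \<phi>)
    then show ?thesis by simp
  qed
  then show "\<exists>C\<ge>0. \<exists>N. \<forall>\<phi>\<in>test_functions U. closure {x. \<phi> x \<noteq> 0} \<subseteq> K \<longrightarrow>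
      (\<forall>M. (\<forall>u x. length u \<le> N \<longrightarrow> \<bar>fold pd u \<phi> x\<bar> \<le> M) \<longrightarrow> \<bar>- T (pd j \<phi>)\<bar> \<le> C * M)"
    using CN(1) by (intro exI[of _ C] conjI exI[of _ "Suc N"]) auto
qed

text \<open>The mean value theorem gains one power of the norm for each order of vanishing.\<close>

lemma vanishing_derivatives_bound:
  assumes "smooth_on UNIV g" "\<And>u. length u < n \<Longrightarrow> fold pd u g 0 = 0"
  shows "\<exists>M\<ge>0. \<forall>x\<in>cball 0 1. \<bar>g x\<bar> \<le> M * norm x ^ n"
  using assms
proof (induction n arbitrary: g)
  case 0
  have "compact (g ` cball 0 1)"
    using smooth_on_continuous[OF 0(1)]
    by (intro compact_continuous_image) (auto intro: continuous_on_subset)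
  then obtain M where "\<forall>y\<in>g ` cball 0 1. norm y \<le> M"
    using compact_imp_bounded bounded_iff by blast
  then have "\<forall>x\<in>cball 0 1. \<bar>g x\<bar> \<le> max M 0 * norm x ^ 0" by auto
  then show ?case by (intro exI[of _ "max M 0"]) simp
next
  case (Suc n)
  have "\<exists>M\<ge>0. \<forall>x\<in>cball 0 1. \<bar>pd j g x\<bar> \<le> M * norm x ^ n" for j
    using Suc.prems(2)[of "j # _"] by (intro Suc.IH smooth_on_pd Suc.prems) auto
  then obtain M where M: "\<And>j. 0 \<le> M j" "\<And>j x. x \<in> cball 0 1 \<Longrightarrow> \<bar>pd j g x\<bar> \<le> M j * norm x ^ n"
    by metis
  have "\<bar>g x\<bar> \<le> (\<Sum>j\<in>UNIV. M j) * norm x ^ Suc n" if x: "x \<in> cball 0 1" for x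
  proof -
    obtain t where t: "t \<in> {0<..<1}" "g (0 + x) - g 0 = (\<Sum>j\<in>UNIV. x $ j * pd j g (0 + t *\<^sub>R x))"
      using mean_value_pd[of g 0 x] smooth_on_differentiable[OF Suc.prems(1)] by auto
    have nt: "norm (t *\<^sub>R x) \<le> norm x"
      using t(1) by (simp add: mult_left_le_one_le)
    have "\<bar>g x\<bar> \<le> (\<Sum>j\<in>UNIV. \<bar>x $ j * pd j g (t *\<^sub>R x)\<bar>)"
      using t(2) Suc.prems(2)[of "[]"] by simp
    also have "\<dots> \<le> (\<Sum>j\<in>UNIV. norm x * (M j * norm x ^ n))"
    proof (rule sum_mono)
      fix j :: 2
      have "\<bar>pd j g (t *\<^sub>R x)\<bar> \<le> M j * norm (t *\<^sub>R x) ^ n"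
        using x nt by (intro M(2)) auto
      also have "\<dots> \<le> M j * norm x ^ n"
        using nt M(1)[of j] by (intro mult_left_mono power_mono) auto
      finally show "\<bar>x $ j * pd j g (t *\<^sub>R x)\<bar> \<le> norm x * (M j * norm x ^ n)"
        unfolding abs_mult by (intro mult_mono component_le_norm_cart) auto
    qed
    also have "\<dots> = (\<Sum>j\<in>UNIV. M j) * norm x ^ Suc n"
      by (simp add: sum_distrib_left sum_distrib_right algebra_simps)
    finally show ?thesis .
  qed
  then show ?case using M(1) by (intro exI[of _ "\<Sum>j\<in>UNIV. M j"]) (auto intro: sum_nonneg)
qed

lemma finite_words: "finite {u :: 2 list. length u \<le> N}"
  using finite_lists_length_le[of "UNIV :: 2 set" N] by simp

lemma test_functions_derivatives_bounded:
  assumes "\<phi> \<in> test_functions U"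
  shows "\<exists>M\<ge>0. \<forall>u x. length u \<le> N \<longrightarrow> \<bar>fold pd u \<phi> x\<bar> \<le> M"
proof -
  have "fold pd u \<phi> \<in> test_functions U" for u
    using assms by (induction u arbitrary: \<phi>) (auto intro: test_functions_pd)
  then have "\<exists>M\<ge>0. \<forall>x. \<bar>fold pd u \<phi> x\<bar> \<le> M" for u by (rule test_functions_bounded)
  then obtain M where M: "\<And>u. 0 \<le> M u" "\<And>u x. \<bar>fold pd u \<phi> x\<bar> \<le> M u" by metis
  have "\<bar>fold pd u \<phi> x\<bar> \<le> (\<Sum>u | length u \<le> N. M u)" if "length u \<le> N" for u x
    using M(2)[of u x] member_le_sum[of u "{u. length u \<le> N}" M] that M(1) finite_words
    by fastforce
  then show ?thesis using M(1) by (intro exI[of _ "\<Sum>u | length u \<le> N. M u"]) (auto intro: sum_nonneg)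
qed

text \<open>Because \<open>T\<close> ignores what happens away from the origin, its value at \<open>\<phi>\<close> does not change if \<open>\<phi>\<close> is
  multiplied by a cutoff function concentrated on a ball of radius \<open>\<epsilon>\<close>. Derivatives of the cutoff of order \<open>k\<close> grow like \<open>\<epsilon>\<close> to the power \<open>-k\<close>, but if
  all derivatives of \<open>\<phi>\<close> up to order \<open>N\<close> vanish at the origin, then \<open>\<phi>\<close> is small enough there for the
  seminorms of the product up to order \<open>N\<close> to be of size \<open>\<epsilon>\<close>.\<close>

lemma concentrated_vanishes:
  assumes \<Omega>: "open \<Omega>" "0 \<in> \<Omega>" and T: "test_linear \<Omega> T" "locally_finite_order \<Omega> T"
    and conc: "\<And>\<phi>. \<phi> \<in> test_functions (\<Omega> - {0}) \<Longrightarrow> T \<phi> = 0"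
  shows "\<exists>N. \<forall>\<phi>\<in>test_functions \<Omega>. (\<forall>u. length u \<le> N \<longrightarrow> fold pd u \<phi> 0 = 0) \<longrightarrow> T \<phi> = 0"
proof -
  obtain e1 where "0 < e1" "cball 0 e1 \<subseteq> \<Omega>" using \<Omega> open_contains_cball by blast
  then obtain e where e: "0 < e" "e \<le> 1" "cball 0 e \<subseteq> \<Omega>"
    by (intro that[of "min e1 1"]) auto
  obtain C N where C: "0 \<le> C" and CN: "\<And>\<phi> M. \<phi> \<in> test_functions \<Omega> \<Longrightarrow> closure {x. \<phi> x \<noteq> 0} \<subseteq> cball 0 e \<Longrightarrow>
      (\<And>u x. length u \<le> N \<Longrightarrow> \<bar>fold pd u \<phi> x\<bar> \<le> M) \<Longrightarrow> \<bar>T \<phi>\<bar> \<le> C * M"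
    using locally_finite_orderE[OF T(2) compact_cball e(3)] by metis
  obtain \<theta> :: "real^2 \<Rightarrow> real" where \<theta>: "smooth_on UNIV \<theta>"
    "\<And>x. norm x \<le> 1 / 2 \<Longrightarrow> \<theta> x = 1" "\<And>x. 1 \<le> norm x \<Longrightarrow> \<theta> x = 0"
    using exists_cutoff_at_0 by metis
  have "\<theta> \<in> test_functions UNIV"
    using \<theta> by (intro test_functionsI[of _ "cball 0 1"]) auto
  then obtain B where B: "0 \<le> B" "\<And>u x. length u \<le> N \<Longrightarrow> \<bar>fold pd u \<theta> x\<bar> \<le> B"
    using test_functions_derivatives_bounded by metis
  have "T \<phi> = 0" if \<phi>: "\<phi> \<in> test_functions \<Omega>" and v: "\<And>u. length u \<le> N \<Longrightarrow> fold pd u \<phi> 0 = 0" for \<phi>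
  proof -
    have sm: "smooth_on UNIV \<phi>" using \<phi> by (rule test_functions_smooth)
    have "\<exists>A\<ge>0. \<forall>x\<in>cball 0 1. \<bar>fold pd u \<phi> x\<bar> \<le> A * norm x ^ (N + 1 - length u)" if "length u \<le> N" for u
    proof (rule vanishing_derivatives_bound[OF smooth_on_fold_pd[OF sm]])
      fix u' :: "2 list" assume "length u' < N + 1 - length u"
      then show "fold pd u' (fold pd u \<phi>) 0 = 0" using v[of "u @ u'"] that by simp
    qed
    then obtain A0 where A0: "\<And>u. length u \<le> N \<Longrightarrow> 0 \<le> A0 u"
      "\<And>u x. length u \<le> N \<Longrightarrow> x \<in> cball 0 1 \<Longrightarrow> \<bar>fold pd u \<phi> x\<bar> \<le> A0 u * norm x ^ (N + 1 - length u)"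
      by metis
    define A where "A = (\<Sum>u | length u \<le> N. A0 u)"
    have A: "0 \<le> A" unfolding A_def using A0(1) by (intro sum_nonneg) auto
    have A0_le: "A0 u \<le> A" if "length u \<le> N" for u
      unfolding A_def using that A0(1) finite_words by (intro member_le_sum) auto
    have bound: "\<bar>T \<phi>\<bar> \<le> (C * (A * B * 2 ^ N)) * \<epsilon>" if \<epsilon>: "0 < \<epsilon>" "\<epsilon> \<le> e" for \<epsilon>
    proof -
      define \<theta>' where "\<theta>' x = \<theta> ((1 / \<epsilon>) *\<^sub>R (x - 0))" for x
      have \<theta>'_sm: "smooth_on UNIV \<theta>'" unfolding \<theta>'_def using \<theta>(1) by (rule smooth_on_affine)
      have \<theta>'0: "\<theta>' x = 0" if "\<epsilon> \<le> norm x" for x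
        unfolding \<theta>'_def using that \<epsilon>(1) by (intro \<theta>(3)) simp
      have \<theta>'1: "\<theta>' x = 1" if "norm x \<le> \<epsilon> / 2" for x
        unfolding \<theta>'_def using that \<epsilon>(1) by (intro \<theta>(2)) (simp add: field_simps)
      define \<psi> where "\<psi> x = \<phi> x * \<theta>' x" for x
      define \<rho> where "\<rho> x = \<phi> x * (1 - \<theta>' x)" for x
      have smp: "smooth_on UNIV \<psi>" "smooth_on UNIV \<rho>"
        unfolding \<psi>_def \<rho>_def using sm \<theta>'_sm
        by (auto intro!: smooth_on_mult smooth_on_diff smooth_on_const)
      have \<psi>t: "\<psi> \<in> test_functions \<Omega>"
        using \<phi> smp(1) by (rule test_functions_support) (simp add: \<psi>_def)
      obtain K where K: "compact K" "K \<subseteq> \<Omega>" "\<And>x. x \<notin> K \<Longrightarrow> \<phi> x = 0"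
        using test_functionsE[OF \<phi>] by metis
      have \<rho>t: "\<rho> \<in> test_functions (\<Omega> - {0})"
      proof (rule test_functionsI[OF smp(2)])
        show "compact (K - ball 0 (\<epsilon> / 2))" using K(1) by (intro compact_diff) auto
        show "K - ball 0 (\<epsilon> / 2) \<subseteq> \<Omega> - {0}" using K(2) \<epsilon>(1) by auto
        show "\<rho> x = 0" if "x \<notin> K - ball 0 (\<epsilon> / 2)" for x
          using that K(3)[of x] \<theta>'1[of x] by (auto simp: \<rho>_def)
      qed
      have "\<phi> = (\<lambda>x. \<psi> x + \<rho> x)" by (auto simp: \<psi>_def \<rho>_def algebra_simps)
      then have "T \<phi> = T \<psi> + T \<rho>"
        using test_linear_add[OF T(1) \<psi>t test_functions_mono[OF \<rho>t]] by auto
      then have eq: "T \<phi> = T \<psi>" using conc[OF \<rho>t] by simp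
      have zero: "\<psi> x = 0" if "x \<notin> cball 0 \<epsilon>" for x
        using \<theta>'0[of x] that by (simp add: \<psi>_def)
      have "closure {x. \<psi> x \<noteq> 0} \<subseteq> cball 0 \<epsilon>"
        by (intro closure_minimal) (use zero in blast, simp)
      also have "\<dots> \<subseteq> cball 0 e" using \<epsilon>(2) by auto
      finally have supp: "closure {x. \<psi> x \<noteq> 0} \<subseteq> cball 0 e" .
      have der: "\<bar>fold pd u \<psi> x\<bar> \<le> A * B * 2 ^ N * \<epsilon>" if u: "length u \<le> N" for u x
      proof (cases "x \<in> cball 0 \<epsilon>")
        case True
        then have x: "norm x \<le> \<epsilon>" "x \<in> cball 0 1" using \<epsilon>(2) e(2) by auto
        have pow: "\<epsilon> ^ (N + 1 - l) = \<epsilon> ^ (N + 1) * (1 / \<epsilon>) ^ l" if "l \<le> N" for l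
          using that \<epsilon>(1) by (simp add: power_diff power_one_over divide_inverse power_inverse)
        have f: "\<bar>fold pd v \<phi> x\<bar> \<le> (A * \<epsilon> ^ (N + 1)) * (1 / \<epsilon>) ^ length v" if v: "length v \<le> N" for v
        proof -
          have "\<bar>fold pd v \<phi> x\<bar> \<le> A0 v * norm x ^ (N + 1 - length v)" by (rule A0(2)[OF v x(2)])
          also have "\<dots> \<le> A * \<epsilon> ^ (N + 1 - length v)"
            using A0_le[OF v] x(1) A by (intro mult_mono power_mono) auto
          finally show ?thesis using pow[OF v] by (simp add: mult.assoc)
        qed
        have g: "\<bar>fold pd v \<theta>' x\<bar> \<le> B * (1 / \<epsilon>) ^ length v" if v: "length v \<le> N" for v
        proof -
          have "fold pd v \<theta>' x = (1 / \<epsilon>) ^ length v * fold pd v \<theta> ((1 / \<epsilon>) *\<^sub>R (x - 0))"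
            unfolding \<theta>'_def by (subst fold_pd_affine[OF \<theta>(1)]) simp
          then show ?thesis using B(2)[OF v, of "(1 / \<epsilon>) *\<^sub>R x"] \<epsilon>(1)
            by (simp add: abs_mult mult.commute divide_right_mono power_one_over)
        qed
        have "\<bar>fold pd u \<psi> x\<bar> \<le> (A * \<epsilon> ^ (N + 1)) * B * (2 * (1 / \<epsilon>)) ^ length u"
          unfolding \<psi>_def using f g A B(1) \<epsilon>(1) u
          by (intro fold_pd_mult_bound[OF sm \<theta>'_sm, where n = N]) auto
        also have "\<dots> = A * B * (2 ^ length u * \<epsilon> ^ (N + 1 - length u))"
          unfolding pow[OF u] power_mult_distrib by (simp add: mult_ac)
        also have "\<dots> \<le> A * B * (2 ^ N * \<epsilon> ^ 1)"
          using u \<epsilon> e A B(1)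
          by (intro mult_left_mono mult_mono power_increasing power_decreasing) auto
        finally show ?thesis by simp
      next
        case False
        have "fold pd u \<psi> x = fold pd u (\<lambda>x. 0) x"
          by (rule fold_pd_cong_open[of "- cball 0 \<epsilon>"]) (use zero False in auto)
        then show ?thesis using A B(1) \<epsilon>(1) by simp
      qed
      show ?thesis using CN[OF \<psi>t supp der] eq by (simp add: mult.assoc)
    qed
    have "\<bar>T \<phi>\<bar> \<le> 0 + \<delta>" if "0 < \<delta>" for \<delta>
    proof -
      define D where "D = C * (A * B * 2 ^ N)"
      have D: "0 \<le> D" unfolding D_def using C A B(1) by simp
      have "\<bar>T \<phi>\<bar> \<le> D * min e (\<delta> / (D + 1))"
        unfolding D_def using e(1) that D[unfolded D_def] by (intro bound) auto
      also have "\<dots> \<le> D * (\<delta> / (D + 1))" using D by (intro mult_left_mono) auto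
      also have "\<dots> \<le> \<delta>" using D that by (simp add: field_simps)
      finally show ?thesis by simp
    qed
    then have "\<bar>T \<phi>\<bar> \<le> 0" by (rule field_le_epsilon)
    then show ?thesis by simp
  qed
  then show ?thesis by blast
qed

lemma fold_pd_sum:
  "finite A \<Longrightarrow> (\<And>a. a \<in> A \<Longrightarrow> smooth_on UNIV (f a)) \<Longrightarrow>
    fold pd u (\<lambda>x. \<Sum>a\<in>A. f a x) = (\<lambda>x. \<Sum>a\<in>A. fold pd u (f a) x) \<and> smooth_on UNIV (\<lambda>x. \<Sum>a\<in>A. f a x)"
  by (induction A rule: finite_induct) (auto simp: fold_pd_add smooth_on_add smooth_on_const)

text \<open>Subtracting from \<open>\<phi>\<close> its Taylor polynomial, realised with the functions \<open>w \<alpha>\<close>, leaves a function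
  whose derivatives up to the order \<open>N\<close> vanish at the origin.\<close>

lemma concentrated_expansion:
  assumes \<Omega>: "open \<Omega>" "0 \<in> \<Omega>" and T: "test_linear \<Omega> T" "locally_finite_order \<Omega> T"
    and conc: "\<And>\<phi>. \<phi> \<in> test_functions (\<Omega> - {0}) \<Longrightarrow> T \<phi> = 0"
    and w: "\<And>\<alpha>. w \<alpha> \<in> test_functions \<Omega>"
      "\<And>\<alpha> \<beta>. mi_deriv \<beta> (w \<alpha>) 0 = (if \<beta> = \<alpha> then (-1) ^ mi_order \<alpha> else 0)"
  shows "\<exists>N. \<forall>\<phi>\<in>test_functions \<Omega>.
    T \<phi> = (\<Sum>\<alpha> | mi_order \<alpha> \<le> N. (-1) ^ mi_order \<alpha> * mi_deriv \<alpha> \<phi> 0 * T (w \<alpha>))"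
proof -
  obtain N where N: "\<And>\<phi>. \<phi> \<in> test_functions \<Omega> \<Longrightarrow> (\<And>u. length u \<le> N \<Longrightarrow> fold pd u \<phi> 0 = 0) \<Longrightarrow> T \<phi> = 0"
    using concentrated_vanishes[OF \<Omega> T conc] by blast
  let ?A = "{\<alpha>. mi_order \<alpha> \<le> N}"
  have "T \<phi> = (\<Sum>\<alpha>\<in>?A. (-1) ^ mi_order \<alpha> * mi_deriv \<alpha> \<phi> 0 * T (w \<alpha>))" if \<phi>: "\<phi> \<in> test_functions \<Omega>" for \<phi>
  proof -
    define c where "c \<alpha> = (-1) ^ mi_order \<alpha> * mi_deriv \<alpha> \<phi> 0" for \<alpha>
    define P where "P x = (\<Sum>\<alpha>\<in>?A. c \<alpha> * w \<alpha> x)" for x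
    define \<rho> where "\<rho> x = \<phi> x + (- 1) * P x" for x
    have P: "P \<in> test_functions \<Omega>"
      unfolding P_def using w(1) finite_mi_order_le by (intro test_functions_sum test_functions_cmult) auto
    have \<rho>: "\<rho> \<in> test_functions \<Omega>"
      unfolding \<rho>_def using \<phi> P by (intro test_functions_add test_functions_cmult)
    have sw: "smooth_on UNIV (w \<alpha>)" for \<alpha> using w(1) by (rule test_functions_smooth)
    have "fold pd u \<rho> 0 = 0" if u: "length u \<le> N" for u
    proof -
      obtain \<beta> where \<beta>: "mi_order \<beta> = length u" "fold pd u \<rho> = mi_deriv \<beta> \<rho>"
        using fold_pd_eq_mi_deriv[OF test_functions_smooth[OF \<rho>]] by metis
      let ?v = "replicate (\<beta> $ 2) (2::2) @ replicate (\<beta> $ 1) 1"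
      have "fold pd ?v P = (\<lambda>x. \<Sum>\<alpha>\<in>?A. c \<alpha> * fold pd ?v (w \<alpha>) x)"
        unfolding P_def using finite_mi_order_le sw
        by (subst fold_pd_sum[THEN conjunct1])
          (auto simp only: fold_pd_cmult intro: smooth_on_mult smooth_on_const)
      then have "mi_deriv \<beta> P 0 = (\<Sum>\<alpha>\<in>?A. c \<alpha> * mi_deriv \<beta> (w \<alpha>) 0)"
        unfolding mi_deriv_fold by metis
      also have "\<dots> = (\<Sum>\<alpha>\<in>?A. if \<beta> = \<alpha> then c \<beta> * (-1) ^ mi_order \<beta> else 0)"
        by (intro sum.cong) (auto simp: w(2))
      also have "\<dots> = c \<beta> * (-1) ^ mi_order \<beta>"
        using \<beta>(1) u finite_mi_order_le by (subst sum.delta') auto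
      also have "\<dots> = mi_deriv \<beta> \<phi> 0"
        by (simp add: c_def flip: power_add)
      finally have "mi_deriv \<beta> P 0 = mi_deriv \<beta> \<phi> 0" .
      moreover have "mi_deriv \<beta> \<rho> = (\<lambda>x. mi_deriv \<beta> \<phi> x + (- 1) * mi_deriv \<beta> P x)"
        unfolding mi_deriv_fold \<rho>_def
        using test_functions_smooth[OF \<phi>] test_functions_smooth[OF P]
        by (subst fold_pd_add) (auto simp only: fold_pd_cmult intro: smooth_on_mult smooth_on_const)
      ultimately show ?thesis using \<beta>(2) by simp
    qed
    then have "T \<rho> = 0" by (rule N[OF \<rho>])
    moreover have "T \<rho> = T \<phi> + (- 1) * T P"
      unfolding \<rho>_def using test_linear_add[OF T(1) \<phi> test_functions_cmult[OF P]] test_linear_cmult[OF T(1) P]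
      by metis
    moreover have "T P = (\<Sum>\<alpha>\<in>?A. c \<alpha> * T (w \<alpha>))"
      unfolding P_def using finite_mi_order_le w(1)
      by (subst test_linear_sum[OF T(1)]) (auto simp: test_linear_cmult[OF T(1)] intro: test_functions_cmult)
    ultimately show ?thesis by (simp add: c_def)
  qed
  then show ?thesis by blast
qed

section \<open>Rescaling\<close>

lemma rescale_test_functions:
  assumes \<phi>: "\<phi> \<in> test_functions U" and l: "0 < l" and sub: "\<And>x. x \<in> U \<Longrightarrow> l *\<^sub>R x \<in> V"
  shows "rescale l \<phi> \<in> test_functions V"
proof -
  obtain K where K: "compact K" "K \<subseteq> U" "\<And>x. x \<notin> K \<Longrightarrow> \<phi> x = 0"
    using test_functionsE[OF \<phi>] by metis
  show ?thesis
  proof (rule test_functionsI)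
    have "smooth_on UNIV (\<lambda>x. 1 / l ^ 2 * \<phi> ((1 / l) *\<^sub>R (x - 0)))"
      by (intro smooth_on_mult smooth_on_const smooth_on_affine test_functions_smooth[OF \<phi>]) simp
    then show "smooth_on UNIV (rescale l \<phi>)" by (simp add: rescale_def [abs_def])
    show "compact ((*\<^sub>R) l ` K)" using K(1) by (rule compact_scaling)
    show "(*\<^sub>R) l ` K \<subseteq> V" using sub K(2) by auto
    show "rescale l \<phi> x = 0" if "x \<notin> (*\<^sub>R) l ` K" for x
    proof -
      have "x = l *\<^sub>R ((1 / l) *\<^sub>R x)" using l by simp
      then have "(1 / l) *\<^sub>R x \<notin> K" using that by blast
      then show ?thesis using K(3) by (simp add: rescale_def)
    qed
  qed
qed

lemma rescale_test_functions_ball: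
  assumes "\<phi> \<in> test_functions (ball 0 r)" "0 < l" "l \<le> 1"
  shows "rescale l \<phi> \<in> test_functions (ball 0 r)"
proof (rule rescale_test_functions[OF assms(1,2)])
  fix x :: "real^2" assume "x \<in> ball 0 r"
  moreover have "l * norm x \<le> 1 * norm x" using assms by (intro mult_right_mono) auto
  ultimately show "l *\<^sub>R x \<in> ball 0 r" using assms(2) by simp
qed

lemma fold_pd_rescale:
  assumes "smooth_on UNIV \<phi>"
  shows "fold pd u (rescale l \<phi>) = (\<lambda>x. (1 / l) ^ length u * rescale l (fold pd u \<phi>) x)"
proof -
  have "rescale l \<phi> = (\<lambda>x. 1 / l ^ 2 * \<phi> ((1 / l) *\<^sub>R (x - 0)))"
    by (simp add: rescale_def [abs_def])
  then show ?thesis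
    by (simp only: fold_pd_cmult[OF smooth_on_affine[OF assms]] fold_pd_affine[OF assms])
      (simp add: rescale_def mult.left_commute)
qed

lemma pd_rescale:
  "smooth_on UNIV \<phi> \<Longrightarrow> pd j (rescale l \<phi>) = (\<lambda>x. (1 / l) * rescale l (pd j \<phi>) x)"
  using fold_pd_rescale[of \<phi> "[j]"] by simp

lemma rescale_rescale: "rescale l (rescale m \<phi>) = rescale (l * m) \<phi>"
  by (auto simp: rescale_def power_mult_distrib mult_ac)

lemma tendsto_powr_increase:
  fixes F :: "real \<Rightarrow> real"
  assumes "((\<lambda>l. l powr k * F l) \<longlongrightarrow> 0) (at_right 0)" "k \<le> m"
  shows "((\<lambda>l. l powr m * F l) \<longlongrightarrow> 0) (at_right 0)"
proof (rule Lim_null_comparison[OF _ tendsto_norm_zero[OF assms(1)]])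
  have "norm (l powr m * F l) \<le> norm (l powr k * F l)" if "0 < l" "l < 1" for l
  proof -
    have "l powr m \<le> l powr k" using that assms(2) by (intro powr_mono') auto
    then show ?thesis by (simp add: abs_mult mult_right_mono)
  qed
  then show "\<forall>\<^sub>F l in at_right 0. norm (l powr m * F l) \<le> norm (l powr k * F l)"
    using eventually_at_right_less[of 0] eventually_at_right_field[of _ "0::real"] by (metis (mono_tags, lifting) zero_less_one)
qed

text \<open>Rescaling the test function by \<open>l\<close> multiplies its derivatives of order \<open>k\<close> at the origin
  by \<open>l\<close> to the power \<open>-(k + 2)\<close>. So a coefficient of order \<open>k\<close> in the expansion vanishes if the rescaled
  functional grows more slowly than that.\<close>

lemma concentrated_eq_0:
  assumes \<Omega>: "open \<Omega>" "0 \<in> \<Omega>" "bounded \<Omega>" and r: "0 < r" "ball 0 r \<subseteq> \<Omega>"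
    and T: "test_linear \<Omega> T" "locally_finite_order \<Omega> T"
    and conc: "\<And>\<phi>. \<phi> \<in> test_functions (\<Omega> - {0}) \<Longrightarrow> T \<phi> = 0"
    and w: "\<And>\<alpha>. w \<alpha> \<in> test_functions \<Omega>"
      "\<And>\<alpha> \<beta>. mi_deriv \<beta> (w \<alpha>) 0 = (if \<beta> = \<alpha> then (-1) ^ mi_order \<alpha> else 0)"
    and lim: "\<And>\<alpha> \<phi>. T (w \<alpha>) \<noteq> 0 \<Longrightarrow> \<phi> \<in> test_functions (ball 0 r) \<Longrightarrow>
      ((\<lambda>l. l powr real (mi_order \<alpha> + 2) * T (rescale l \<phi>)) \<longlongrightarrow> 0) (at_right 0)"
    and \<phi>: "\<phi> \<in> test_functions \<Omega>"
  shows "T \<phi> = 0"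
proof -
  obtain N where N: "\<And>\<phi>. \<phi> \<in> test_functions \<Omega> \<Longrightarrow>
      T \<phi> = (\<Sum>\<alpha> | mi_order \<alpha> \<le> N. (-1) ^ mi_order \<alpha> * mi_deriv \<alpha> \<phi> 0 * T (w \<alpha>))"
    using concentrated_expansion[OF \<Omega>(1,2) T conc w] by blast
  let ?A = "{\<alpha>. mi_order \<alpha> \<le> N}"
  have "T (w \<alpha>) = 0" if \<alpha>: "\<alpha> \<in> ?A" for \<alpha>
  proof (rule ccontr)
    assume nz: "T (w \<alpha>) \<noteq> 0"
    \<comment> \<open>A fixed rescaling moves the support of \<open>w \<alpha>\<close> into the ball on which \<open>lim\<close> applies. It multiplies the
      only nonzero derivative at the origin by a nonzero factor.\<close>
    obtain R where R: "0 < R" "\<Omega> \<subseteq> ball 0 R"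
      using bounded_subset_ballD[OF \<Omega>(3)] by blast
    define m where "m = r / R"
    have m: "0 < m" using r(1) R(1) by (simp add: m_def)
    have in_ball: "rescale m (w \<alpha>) \<in> test_functions (ball 0 r)"
    proof (rule rescale_test_functions[OF w(1) m])
      fix x assume "x \<in> \<Omega>"
      then have "norm x < R" using R(2) by auto
      then show "m *\<^sub>R x \<in> ball 0 r" using r(1) R(1) by (simp add: m_def field_simps)
    qed
    have const: "l powr real (mi_order \<alpha> + 2) * T (rescale l (rescale m (w \<alpha>))) =
        (1 / m) ^ (mi_order \<alpha> + 2) * T (w \<alpha>)" if l: "0 < l" "l < 1" for l
    proof -
      have lm: "0 < l * m" using l m by simp
      have t: "rescale (l * m) (w \<alpha>) \<in> test_functions \<Omega>"
        using rescale_test_functions_ball[OF in_ball, of l] l r(2)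
        by (simp add: rescale_rescale test_functions_mono)
      have der: "mi_deriv \<beta> (rescale (l * m) (w \<alpha>)) 0 =
          (if \<beta> = \<alpha> then (1 / (l * m)) ^ (mi_order \<alpha> + 2) * (-1) ^ mi_order \<alpha> else 0)" for \<beta>
      proof -
        have "mi_deriv \<beta> (rescale (l * m) (w \<alpha>)) 0 =
            (1 / (l * m)) ^ mi_order \<beta> * (1 / (l * m) ^ 2 * mi_deriv \<beta> (w \<alpha>) 0)"
          unfolding mi_deriv_fold fold_pd_rescale[OF test_functions_smooth[OF w(1)]]
          by (simp add: rescale_def mi_order_def add.commute)
        then show ?thesis by (simp add: w(2) power_add power_one_over power2_eq_square)
      qed
      have "T (rescale (l * m) (w \<alpha>)) = (\<Sum>\<beta>\<in>?A. if \<beta> = \<alpha> then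
          (-1) ^ mi_order \<alpha> * ((1 / (l * m)) ^ (mi_order \<alpha> + 2) * (-1) ^ mi_order \<alpha>) * T (w \<alpha>) else 0)"
        unfolding N[OF t] by (intro sum.cong) (simp_all add: der)
      also have "\<dots> = (-1) ^ mi_order \<alpha> * ((1 / (l * m)) ^ (mi_order \<alpha> + 2) * (-1) ^ mi_order \<alpha>) * T (w \<alpha>)"
        using \<alpha> finite_mi_order_le by (subst sum.delta) auto
      also have "\<dots> = (1 / (l * m)) ^ (mi_order \<alpha> + 2) * T (w \<alpha>)"
        using power_add[of "-1::real" "mi_order \<alpha>" "mi_order \<alpha>"] by (simp add: mult_ac)
      finally have "T (rescale (l * m) (w \<alpha>)) = (1 / (l * m)) ^ (mi_order \<alpha> + 2) * T (w \<alpha>)" .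
      moreover have "l powr real (mi_order \<alpha> + 2) = l ^ (mi_order \<alpha> + 2)"
        by (rule powr_realpow[OF l(1)])
      moreover have "l ^ (mi_order \<alpha> + 2) * (1 / (l * m)) ^ (mi_order \<alpha> + 2) = (1 / m) ^ (mi_order \<alpha> + 2)"
        unfolding power_mult_distrib[symmetric] using l by simp
      ultimately show ?thesis by (simp only: rescale_rescale mult.assoc[symmetric])
    qed
    have "((\<lambda>l::real. (1 / m) ^ (mi_order \<alpha> + 2) * T (w \<alpha>)) \<longlongrightarrow> 0) (at_right 0)"
    proof (rule Lim_transform_eventually[OF lim[OF nz in_ball]])
      have "\<forall>\<^sub>F l in at_right (0::real). 0 < l \<and> l < 1"
        unfolding eventually_at_right_field by (intro exI[of _ 1]) auto
      then show "\<forall>\<^sub>F l in at_right 0. l powr real (mi_order \<alpha> + 2) * T (rescale l (rescale m (w \<alpha>))) =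
          (1 / m) ^ (mi_order \<alpha> + 2) * T (w \<alpha>)"
        by (rule eventually_mono) (use const in blast)
    qed
    then show False using nz m by (simp add: tendsto_const_iff)
  qed
  then show ?thesis unfolding N[OF \<phi>] by (intro sum.neutral) auto
qed

section \<open>The equilibrium residual\<close>

text \<open>The component \<open>i\<close> of the distribution \<open>Div \<sigma> + B\<close>.\<close>

definition residual :: "functional^2^2 \<Rightarrow> functional^2 \<Rightarrow> 2 \<Rightarrow> functional"
  where "residual \<sigma> B i \<phi> = (B $ i) \<phi> - (\<Sum>j\<in>UNIV. (\<sigma> $ i $ j) (pd j \<phi>))"

lemma Div_plus_eq_residual:
  "Div \<sigma> \<psi> + act_vec B \<psi> = (\<Sum>i\<in>UNIV. residual \<sigma> B i (\<lambda>x. \<psi> x $ i))"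
proof -
  have "(\<lambda>x. grad \<psi> x $ i $ j) = pd j (\<lambda>x. \<psi> x $ i)" for i j
    by (simp add: grad_def)
  then show ?thesis
    by (simp add: Div_def act_tens_def act_vec_def residual_def sum_subtractf)
qed

lemma residual_test_linear:
  assumes "\<And>j. test_linear U (\<sigma> $ i $ j)" "test_linear U (B $ i)"
  shows "test_linear U (residual \<sigma> B i)"
  unfolding test_linear_def
proof (intro conjI ballI allI)
  fix \<phi> \<psi> and c :: real
  assume \<phi>: "\<phi> \<in> test_functions U"
  have s: "smooth_on UNIV \<phi>" using \<phi> by (rule test_functions_smooth)
  have "pd j (\<lambda>x. c * \<phi> x) = (\<lambda>x. c * pd j \<phi> x)" for j
    using fold_pd_cmult[OF s, of "[j]"] by simp
  then show "residual \<sigma> B i (\<lambda>x. c * \<phi> x) = c * residual \<sigma> B i \<phi>"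
    using assms \<phi>
    by (simp add: residual_def test_linear_cmult[of U] test_functions_pd right_diff_distrib sum_distrib_left)
  assume \<psi>: "\<psi> \<in> test_functions U"
  have "pd j (\<lambda>x. \<phi> x + \<psi> x) = (\<lambda>x. pd j \<phi> x + pd j \<psi> x)" for j
    using fold_pd_add[OF s test_functions_smooth[OF \<psi>], of "[j]"] by simp
  then show "residual \<sigma> B i (\<lambda>x. \<phi> x + \<psi> x) = residual \<sigma> B i \<phi> + residual \<sigma> B i \<psi>"
    using assms \<phi> \<psi>
    by (simp add: residual_def test_linear_add[of U] test_functions_pd sum.distrib)
qed

lemma residual_locally_finite_order:
  assumes "\<And>j. locally_finite_order U (\<sigma> $ i $ j)" "locally_finite_order U (B $ i)"
  shows "locally_finite_order U (residual \<sigma> B i)"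
proof -
  have "residual \<sigma> B i = (\<lambda>\<phi>. ((B $ i) \<phi> + - (\<sigma> $ i $ 1) (pd 1 \<phi>)) + - (\<sigma> $ i $ 2) (pd 2 \<phi>))"
    by (auto simp: residual_def sum_2)
  then show ?thesis
    using assms by (simp only: locally_finite_order_add locally_finite_order_minus_pd)
qed

lemma Div_plus_component:
  assumes "\<And>j k. test_linear U (\<sigma> $ k $ j)" "\<And>k. test_linear U (B $ k)"
  shows "- act_tens \<sigma> (grad (\<lambda>x. \<phi> x *\<^sub>R axis i 1)) + act_vec B (\<lambda>x. \<phi> x *\<^sub>R axis i 1) = residual \<sigma> B i \<phi>"
proof -
  have "residual \<sigma> B k (\<lambda>x. (\<phi> x *\<^sub>R axis i 1) $ k) = (if k = i then residual \<sigma> B i \<phi> else 0)" for k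
    using test_linear_zero[OF residual_test_linear[of U \<sigma> k B]] assms by (simp add: axis_def)
  then show ?thesis
    using Div_plus_eq_residual[of \<sigma> "\<lambda>x. \<phi> x *\<^sub>R axis i 1" B] by (simp add: Div_def)
qed

text \<open>Equilibrium componentwise: a vector valued test function is a sum of test functions
  \<open>\<phi> *\<^sub>R axis i 1\<close>.\<close>

lemma equilibrium_iff_residual:
  assumes "\<And>j k. test_linear U (\<sigma> $ k $ j)" "\<And>k. test_linear U (B $ k)"
  shows "(\<forall>\<psi>\<in>vec_test_functions U. Div \<sigma> \<psi> + act_vec B \<psi> = 0) \<longleftrightarrow>
    (\<forall>i. \<forall>\<phi>\<in>test_functions U. residual \<sigma> B i \<phi> = 0)"
proof (intro iffI allI ballI)
  fix i \<phi> assume eq: "\<forall>\<psi>\<in>vec_test_functions U. Div \<sigma> \<psi> + act_vec B \<psi> = 0" and \<phi>: "\<phi> \<in> test_functions U"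
  have "(\<lambda>x. \<phi> x *\<^sub>R axis i 1) \<in> vec_test_functions U"
    using \<phi> by (auto simp: vec_test_functions_def axis_def)
  then show "residual \<sigma> B i \<phi> = 0"
    using eq Div_plus_component[OF assms, of \<phi> i] by (simp add: Div_def)
next
  fix \<psi> assume "\<forall>i. \<forall>\<phi>\<in>test_functions U. residual \<sigma> B i \<phi> = 0" "\<psi> \<in> vec_test_functions U"
  then show "Div \<sigma> \<psi> + act_vec B \<psi> = 0"
    by (simp add: Div_plus_eq_residual vec_test_functions_def)
qed

lemma residual_classical:
  assumes "open U" "\<And>j. given_by U (\<sigma> $ i $ j) (s j)" "given_by U (B $ i) b" "\<phi> \<in> test_functions U"
  shows "residual \<sigma> B i \<phi> = (LINT x|lborel. ((\<Sum>j\<in>UNIV. pd j (s j) x) + b x) * \<phi> x)"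
proof -
  have sm: "\<And>j. smooth_on U (s j)" "smooth_on U b"
    using assms(2,3) by (auto simp: given_by_def)
  have int: "integrable lborel (\<lambda>x. pd j (s j) x * \<phi> x)" "integrable lborel (\<lambda>x. b x * \<phi> x)" for j
    using sm assms(4)
    by (auto intro!: integrable_continuous_mult_test[of U] smooth_on_continuous smooth_on_pd)
  have "(\<sigma> $ i $ j) (pd j \<phi>) = - (LINT x|lborel. pd j (s j) x * \<phi> x)" for j
    using assms(2)[of j] integral_by_parts[OF assms(1) sm(1) assms(4)] test_functions_pd[OF assms(4)]
    by (simp add: given_by_def)
  then have "residual \<sigma> B i \<phi> = (LINT x|lborel. b x * \<phi> x) + (\<Sum>j\<in>UNIV. LINT x|lborel. pd j (s j) x * \<phi> x)"
    using assms(3,4) by (simp add: residual_def given_by_def sum_negf)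
  also have "\<dots> = (LINT x|lborel. b x * \<phi> x + (\<Sum>j\<in>UNIV. pd j (s j) x * \<phi> x))"
    using int by simp
  also have "\<dots> = (LINT x|lborel. ((\<Sum>j\<in>UNIV. pd j (s j) x) + b x) * \<phi> x)"
    by (simp add: sum_distrib_right distrib_right add.commute)
  finally show ?thesis .
qed

lemma residual_eq_0_iff_classical:
  assumes "open U" "\<And>j. given_by U (\<sigma> $ i $ j) (s j)" "given_by U (B $ i) b"
  shows "(\<forall>\<phi>\<in>test_functions U. residual \<sigma> B i \<phi> = 0) \<longleftrightarrow> (\<forall>x\<in>U. (\<Sum>j\<in>UNIV. pd j (s j) x) + b x = 0)"
proof (intro iffI ballI)
  fix x assume z: "\<forall>\<phi>\<in>test_functions U. residual \<sigma> B i \<phi> = 0" and x: "x \<in> U"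
  have "continuous_on U (pd j (s j))" "continuous_on U b" for j
    using assms(2,3) by (auto simp: given_by_def intro!: smooth_on_continuous smooth_on_pd)
  then have "continuous_on U (\<lambda>x. (\<Sum>j\<in>UNIV. pd j (s j) x) + b x)"
    by (intro continuous_on_add continuous_on_sum)
  moreover have "(LINT x|lborel. ((\<Sum>j\<in>UNIV. pd j (s j) x) + b x) * \<phi> x) = 0"
    if "\<phi> \<in> test_functions U" for \<phi>
    using residual_classical[OF assms that] z that by simp
  ultimately show "(\<Sum>j\<in>UNIV. pd j (s j) x) + b x = 0"
    by (rule fundamental_lemma[OF assms(1) _ _ x])
next
  fix \<phi> assume z: "\<forall>x\<in>U. (\<Sum>j\<in>UNIV. pd j (s j) x) + b x = 0" and \<phi>: "\<phi> \<in> test_functions U"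
  obtain K where K: "K \<subseteq> U" "\<And>x. x \<notin> K \<Longrightarrow> \<phi> x = 0" using test_functionsE[OF \<phi>] by metis
  have "((\<Sum>j\<in>UNIV. pd j (s j) x) + b x) * \<phi> x = 0" for x
    using K z by (metis mult_eq_0_iff subsetD)
  then have "(\<lambda>x. ((\<Sum>j\<in>UNIV. pd j (s j) x) + b x) * \<phi> x) = (\<lambda>x. 0)" by blast
  then show "residual \<sigma> B i \<phi> = 0"
    unfolding residual_classical[OF assms \<phi>] by simp
qed

section \<open>Degrees of divergence\<close>

text \<open>The degree of \<open>\<sigma>\<close> is defined with symmetric test functions, and the gradient of \<open>\<psi>\<close> need
  not be symmetric. Since \<open>\<sigma>\<close> is, it takes the same value on the symmetric part of the gradient, which is \<open>S\<close>. The
  factor \<open>l\<close> comes from the chain rule.\<close>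

lemma act_tens_rescale_grad:
  fixes \<psi> :: "real^2 \<Rightarrow> real^2"
  assumes lin: "\<And>i j. test_linear \<Omega> (\<sigma> $ i $ j)"
    and sym: "\<And>i j \<phi>. \<phi> \<in> test_functions \<Omega> \<Longrightarrow> (\<sigma> $ i $ j) \<phi> = (\<sigma> $ j $ i) \<phi>"
    and r: "ball 0 r \<subseteq> \<Omega>" and \<psi>: "\<psi> \<in> vec_test_functions (ball 0 r)"
  shows "\<exists>S\<in>sym_test_functions (ball 0 r).
    \<forall>l\<in>{0<..<1}. act_tens \<sigma> (rescale l S) = l * act_tens \<sigma> (grad (rescale l \<psi>))"
proof -
  define S :: "real^2 \<Rightarrow> real^2^2"
    where "S x = (\<chi> i j. 1 / 2 * (pd j (\<lambda>y. \<psi> y $ i) x + pd i (\<lambda>y. \<psi> y $ j) x))" for x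
  have t: "(\<lambda>x. \<psi> x $ i) \<in> test_functions (ball 0 r)" for i
    using \<psi> by (simp add: vec_test_functions_def)
  have "S \<in> sym_test_functions (ball 0 r)"
    unfolding sym_test_functions_def S_def
    using t by (auto simp: transpose_def vec_eq_iff add.commute
        intro!: test_functions_cmult test_functions_add test_functions_pd simp del: times_divide_eq_left)
  moreover have "act_tens \<sigma> (rescale l S) = l * act_tens \<sigma> (grad (rescale l \<psi>))" if l: "l \<in> {0<..<1}" for l
  proof -
    define R where "R i = rescale l (\<lambda>x. \<psi> x $ i)" for i
    have R_eq: "(\<lambda>x. rescale l \<psi> x $ i) = R i" for i
      by (simp add: R_def rescale_def [abs_def])
    have Rt: "pd j (R i) \<in> test_functions \<Omega>" for i j
      unfolding R_def using l t r
      by (intro test_functions_pd test_functions_mono[OF rescale_test_functions_ball]) auto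
    have S_eq: "(\<lambda>x. rescale l S x $ i $ j) = (\<lambda>x. l / 2 * (pd j (R i) x + pd i (R j) x))" for i j
      unfolding R_def pd_rescale[OF test_functions_smooth[OF t]]
      using l by (intro ext) (simp add: S_def rescale_def field_simps)
    have "(\<sigma> $ i $ j) (\<lambda>x. rescale l S x $ i $ j)
        = l / 2 * ((\<sigma> $ i $ j) (pd j (R i)) + (\<sigma> $ j $ i) (pd i (R j)))" for i j
      unfolding S_eq test_linear_cmult[OF lin test_functions_add[OF Rt Rt]] test_linear_add[OF lin Rt Rt]
      by (simp only: sym[OF Rt, of i j j i] sym[OF Rt, of i j i j])
    then have "act_tens \<sigma> (rescale l S) =
        l / 2 * ((\<Sum>i\<in>UNIV. \<Sum>j\<in>UNIV. (\<sigma> $ i $ j) (pd j (R i))) + (\<Sum>i\<in>UNIV. \<Sum>j\<in>UNIV. (\<sigma> $ j $ i) (pd i (R j))))"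
      by (simp only: act_tens_def sum_distrib_left[symmetric] sum.distrib)
    also have "(\<Sum>i\<in>UNIV. \<Sum>j\<in>UNIV. (\<sigma> $ j $ i) (pd i (R j))) = (\<Sum>i\<in>UNIV. \<Sum>j\<in>UNIV. (\<sigma> $ i $ j) (pd j (R i)))"
      by (rule sum.swap)
    also have "(\<Sum>i\<in>UNIV. \<Sum>j\<in>UNIV. (\<sigma> $ i $ j) (pd j (R i))) = act_tens \<sigma> (grad (rescale l \<psi>))"
      by (simp add: act_tens_def grad_def R_eq)
    finally show ?thesis by simp
  qed
  ultimately show ?thesis by blast
qed

lemma tendsto_act_tens_grad:
  assumes lin: "\<And>i j. test_linear \<Omega> (\<sigma> $ i $ j)"
    and sym: "\<And>i j \<phi>. \<phi> \<in> test_functions \<Omega> \<Longrightarrow> (\<sigma> $ i $ j) \<phi> = (\<sigma> $ j $ i) \<phi>"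
    and r: "ball 0 r \<subseteq> \<Omega>" and \<psi>: "\<psi> \<in> vec_test_functions (ball 0 r)"
    and k: "\<forall>\<phi>\<in>sym_test_functions (ball 0 r). ((\<lambda>l. l powr k * act_tens \<sigma> (rescale l \<phi>)) \<longlongrightarrow> 0) (at_right 0)"
  shows "((\<lambda>l. l powr (k + 1) * act_tens \<sigma> (grad (rescale l \<psi>))) \<longlongrightarrow> 0) (at_right 0)"
proof -
  obtain S where S: "S \<in> sym_test_functions (ball 0 r)"
    "\<And>l. l \<in> {0<..<1} \<Longrightarrow> act_tens \<sigma> (rescale l S) = l * act_tens \<sigma> (grad (rescale l \<psi>))"
    using act_tens_rescale_grad[OF lin sym r \<psi>] by blast
  show ?thesis
  proof (rule Lim_transform_eventually[OF k[rule_format, OF S(1)]])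
    have "\<forall>\<^sub>F l in at_right (0::real). 0 < l \<and> l < 1"
      unfolding eventually_at_right_field by (intro exI[of _ 1]) auto
    then show "\<forall>\<^sub>F l in at_right 0. l powr k * act_tens \<sigma> (rescale l S) =
        l powr (k + 1) * act_tens \<sigma> (grad (rescale l \<psi>))"
      by (rule eventually_mono) (simp add: S(2) powr_add)
  qed
qed

lemma scaling_degree_less_iff:
  "scaling_degree D T < c \<longleftrightarrow>
    (\<exists>k. ereal k < c \<and> (\<forall>\<phi>\<in>D. ((\<lambda>l. l powr k * T (rescale l \<phi>)) \<longlongrightarrow> 0) (at_right 0)))"
  unfolding scaling_degree_def Inf_less_iff by blast

lemma ereal_minus_2_less_iff: "(x::ereal) - 2 < ereal c \<longleftrightarrow> x < ereal (c + 2)"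
  by (cases x) auto

lemma ereal_minus_2_plus_1_less_iff: "(x::ereal) - 2 + 1 < ereal c \<longleftrightarrow> x < ereal (c + 1)"
  by (cases x) (auto simp: one_ereal_def)

text \<open>This form of comparison needs only exponents admissible below a real bound, so that infinite
  degrees require no separate treatment.\<close>

lemma ereal_le_iff_all_less:
  fixes x y :: ereal
  shows "x \<le> y \<longleftrightarrow> (\<forall>c. y < ereal c \<longrightarrow> x < ereal c)"
proof
  assume less: "\<forall>c. y < ereal c \<longrightarrow> x < ereal c"
  show "x \<le> y"
  proof (rule ccontr)
    assume "\<not> x \<le> y"
    then have "y < x" by simp
    from ereal_dense2[OF this] obtain c where "y < ereal c" "ereal c < x" by (elim exE conjE)
    then show False using less[rule_format, of c] by simp
  qed
next
  assume "x \<le> y"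
  then show "\<forall>c. y < ereal c \<longrightarrow> x < ereal c" by (simp add: le_less_trans)
qed

theorem lemma3p3:
  fixes \<Omega> :: "(real^2) set"
    and \<sigma> :: "functional^2^2"
    and B :: "functional^2"
    and r :: real
    and w :: "multi_index \<Rightarrow> real^2 \<Rightarrow> real"
  assumes "bounded \<Omega>" and "open \<Omega>" and "connected \<Omega>" and "0 \<in> \<Omega>"
    and "\<sigma> \<in> A_sym \<Omega>"
    and "B \<in> A_vec \<Omega>"
    and "0 < r" and "ball 0 r \<subseteq> \<Omega>"
    and "\<And>\<alpha>. w \<alpha> \<in> test_functions \<Omega>"
    and "\<And>\<alpha> \<beta>. mi_deriv \<beta> (w \<alpha>) 0 = (if \<beta> = \<alpha> then (-1) ^ mi_order \<alpha> else 0)"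
  shows "(\<forall>\<psi>\<in>vec_test_functions \<Omega>. Div \<sigma> \<psi> + act_vec B \<psi> = 0) \<longleftrightarrow>
    (\<forall>x\<in>\<Omega> - {0}. div_classical (smooth_rep_tens (\<Omega> - {0}) \<sigma>) x
        + smooth_rep_vec (\<Omega> - {0}) B x = 0) \<and>
    (\<forall>\<alpha>. ereal (real (mi_order \<alpha>)) \<le> deg_sym r \<sigma> + 1 \<longrightarrow>
        - act_tens \<sigma> (grad (\<lambda>x. w \<alpha> x *\<^sub>R axis 1 1))
        + act_vec B (\<lambda>x. w \<alpha> x *\<^sub>R axis 1 1) = 0) \<and>
    (\<forall>\<alpha>. ereal (real (mi_order \<alpha>)) \<le> deg_sym r \<sigma> + 1 \<longrightarrow>
        - act_tens \<sigma> (grad (\<lambda>x. w \<alpha> x *\<^sub>R axis 2 1))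
        + act_vec B (\<lambda>x. w \<alpha> x *\<^sub>R axis 2 1) = 0) \<and>
    deg_vec r B \<le> deg_sym r \<sigma> + 1"
proof -
  note \<Omega> = assms(2,4,1) and r = assms(7,8) and w = assms(9,10)
  have A: "\<sigma> $ i $ j \<in> A_scalar \<Omega>" "B $ i \<in> A_scalar \<Omega>" for i j
    using assms(5,6) by (auto simp: A_sym_def A_vec_def)
  have sym: "(\<sigma> $ i $ j) \<phi> = (\<sigma> $ j $ i) \<phi>" if "\<phi> \<in> test_functions \<Omega>" for i j \<phi>
    using assms(5) that by (auto simp: A_sym_def)
  have lin: "test_linear \<Omega> (\<sigma> $ i $ j)" "test_linear \<Omega> (B $ i)" for i j
    using A by (auto intro: A_scalar_test_linear)
  have ord: "locally_finite_order \<Omega> (\<sigma> $ i $ j)" "locally_finite_order \<Omega> (B $ i)" for i j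
    using A by (auto simp: A_scalar_def intro: distributions_locally_finite_order)
  have rep: "given_by (\<Omega> - {0}) (\<sigma> $ i $ j) (smooth_rep (\<Omega> - {0}) (\<sigma> $ i $ j))"
    "given_by (\<Omega> - {0}) (B $ i) (smooth_rep (\<Omega> - {0}) (B $ i))" for i j
    using A \<Omega>(1) by (auto intro: given_by_smooth_rep)
  have open': "open (\<Omega> - {0})" using \<Omega>(1) by auto
  have comp: "- act_tens \<sigma> (grad (\<lambda>x. \<phi> x *\<^sub>R axis i 1)) + act_vec B (\<lambda>x. \<phi> x *\<^sub>R axis i 1) = residual \<sigma> B i \<phi>" for \<phi> i
    using lin by (rule Div_plus_component)
  have classical: "(\<forall>x\<in>\<Omega> - {0}. div_classical (smooth_rep_tens (\<Omega> - {0}) \<sigma>) x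
        + smooth_rep_vec (\<Omega> - {0}) B x = 0) \<longleftrightarrow>
      (\<forall>i. \<forall>\<phi>\<in>test_functions (\<Omega> - {0}). residual \<sigma> B i \<phi> = 0)"
    unfolding residual_eq_0_iff_classical[OF open' rep]
    by (auto simp: vec_eq_iff div_classical_def smooth_rep_tens_def smooth_rep_vec_def)
  have eq: "(\<forall>\<psi>\<in>vec_test_functions \<Omega>. Div \<sigma> \<psi> + act_vec B \<psi> = 0) \<longleftrightarrow>
      (\<forall>i. \<forall>\<phi>\<in>test_functions \<Omega>. residual \<sigma> B i \<phi> = 0)"
    using lin by (rule equilibrium_iff_residual)
  have deg_sym_less: "deg_sym r \<sigma> + 1 < ereal c \<longleftrightarrow> (\<exists>k<c + 1. \<forall>\<phi>\<in>sym_test_functions (ball 0 r).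
      ((\<lambda>l. l powr k * act_tens \<sigma> (rescale l \<phi>)) \<longlongrightarrow> 0) (at_right 0))" for c
    unfolding deg_sym_def ereal_minus_2_plus_1_less_iff scaling_degree_less_iff by simp
  have deg_vec_less: "deg_vec r B < ereal c \<longleftrightarrow> (\<exists>k<c + 2. \<forall>\<psi>\<in>vec_test_functions (ball 0 r).
      ((\<lambda>l. l powr k * act_vec B (rescale l \<psi>)) \<longlongrightarrow> 0) (at_right 0))" for c
    unfolding deg_vec_def ereal_minus_2_less_iff scaling_degree_less_iff by simp
  have grad_tendsto: "((\<lambda>l. l powr (k + 1) * act_tens \<sigma> (grad (rescale l \<psi>))) \<longlongrightarrow> 0) (at_right 0)"
    if "\<psi> \<in> vec_test_functions (ball 0 r)" "\<forall>\<phi>\<in>sym_test_functions (ball 0 r).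
      ((\<lambda>l. l powr k * act_tens \<sigma> (rescale l \<phi>)) \<longlongrightarrow> 0) (at_right 0)" for \<psi> k
    by (rule tendsto_act_tens_grad[OF lin(1) _ r(2) that]) (rule sym)
  \<comment> \<open>A bound on both degrees that is adapted to \<open>residual\<close>: the gradient costs one power of \<open>l\<close>, and the degree
    is the scaling degree minus 2.\<close>
  have res_tendsto: "((\<lambda>l. l powr (c + 2) * residual \<sigma> B i (rescale l \<phi>)) \<longlongrightarrow> 0) (at_right 0)"
    if c: "deg_sym r \<sigma> + 1 < ereal c" "deg_vec r B < ereal c" and \<phi>: "\<phi> \<in> test_functions (ball 0 r)" for c i \<phi>
  proof -
    let ?\<psi> = "\<lambda>x. \<phi> x *\<^sub>R axis i (1::real)"
    have \<psi>: "?\<psi> \<in> vec_test_functions (ball 0 r)"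
      using \<phi> by (auto simp: vec_test_functions_def axis_def)
    have res: "residual \<sigma> B i (rescale l \<phi>) =
        - act_tens \<sigma> (grad (rescale l ?\<psi>)) + act_vec B (rescale l ?\<psi>)" for l
      using comp[of "rescale l \<phi>" i] by (simp add: rescale_def [abs_def])
    obtain k where k: "k < c + 1" "\<forall>\<phi>\<in>sym_test_functions (ball 0 r).
        ((\<lambda>l. l powr k * act_tens \<sigma> (rescale l \<phi>)) \<longlongrightarrow> 0) (at_right 0)"
      using c(1) deg_sym_less by blast
    obtain k' where k': "k' < c + 2" "\<forall>\<psi>\<in>vec_test_functions (ball 0 r).
        ((\<lambda>l. l powr k' * act_vec B (rescale l \<psi>)) \<longlongrightarrow> 0) (at_right 0)"
      using c(2) deg_vec_less by blast
    have "((\<lambda>l. l powr (c + 2) * act_tens \<sigma> (grad (rescale l ?\<psi>))) \<longlongrightarrow> 0) (at_right 0)"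
      by (rule tendsto_powr_increase[OF grad_tendsto[OF \<psi> k(2)]]) (use k(1) in simp)
    moreover have "((\<lambda>l. l powr (c + 2) * act_vec B (rescale l ?\<psi>)) \<longlongrightarrow> 0) (at_right 0)"
      by (rule tendsto_powr_increase[OF k'(2)[rule_format, OF \<psi>]]) (use k'(1) in simp)
    ultimately have "((\<lambda>l. - (l powr (c + 2) * act_tens \<sigma> (grad (rescale l ?\<psi>)))
        + l powr (c + 2) * act_vec B (rescale l ?\<psi>)) \<longlongrightarrow> - 0 + 0) (at_right 0)"
      by (intro tendsto_intros)
    then show ?thesis unfolding res by (simp add: algebra_simps)
  qed
  show ?thesis
    unfolding eq classical comp
  proof (intro iffI conjI)
    assume z: "\<forall>i. \<forall>\<phi>\<in>test_functions \<Omega>. residual \<sigma> B i \<phi> = 0"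
    then show "\<forall>i. \<forall>\<phi>\<in>test_functions (\<Omega> - {0}). residual \<sigma> B i \<phi> = 0"
      by (meson Diff_subset test_functions_mono)
    show "\<forall>\<alpha>. ereal (real (mi_order \<alpha>)) \<le> deg_sym r \<sigma> + 1 \<longrightarrow> residual \<sigma> B 1 (w \<alpha>) = 0"
      "\<forall>\<alpha>. ereal (real (mi_order \<alpha>)) \<le> deg_sym r \<sigma> + 1 \<longrightarrow> residual \<sigma> B 2 (w \<alpha>) = 0"
      using z w(1) by simp_all
    show "deg_vec r B \<le> deg_sym r \<sigma> + 1"
      unfolding ereal_le_iff_all_less
    proof (intro allI impI)
      fix c assume "deg_sym r \<sigma> + 1 < ereal c"
      then obtain k where k: "k < c + 1" "\<forall>\<phi>\<in>sym_test_functions (ball 0 r).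
          ((\<lambda>l. l powr k * act_tens \<sigma> (rescale l \<phi>)) \<longlongrightarrow> 0) (at_right 0)"
        using deg_sym_less by blast
      have "((\<lambda>l. l powr (k + 1) * act_vec B (rescale l \<psi>)) \<longlongrightarrow> 0) (at_right 0)"
        if \<psi>: "\<psi> \<in> vec_test_functions (ball 0 r)" for \<psi>
      proof (rule Lim_transform_eventually[OF grad_tendsto[OF \<psi> k(2)]])
        have "act_tens \<sigma> (grad (rescale l \<psi>)) = act_vec B (rescale l \<psi>)" if l: "0 < l" "l < 1" for l
        proof -
          have "(\<lambda>x. rescale l \<psi> x $ i) \<in> test_functions \<Omega>" for i
          proof -
            have "rescale l (\<lambda>x. \<psi> x $ i) \<in> test_functions (ball 0 r)"
              using \<psi> l by (intro rescale_test_functions_ball) (auto simp: vec_test_functions_def)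
            from test_functions_mono[OF this r(2)] show ?thesis by (simp add: rescale_def [abs_def])
          qed
          then have "Div \<sigma> (rescale l \<psi>) + act_vec B (rescale l \<psi>) = 0"
            using z eq by (simp add: vec_test_functions_def)
          then show ?thesis by (simp add: Div_def)
        qed
        moreover have "\<forall>\<^sub>F l in at_right (0::real). 0 < l \<and> l < 1"
          unfolding eventually_at_right_field by (intro exI[of _ 1]) auto
        ultimately show "\<forall>\<^sub>F l in at_right 0. l powr (k + 1) * act_tens \<sigma> (grad (rescale l \<psi>)) =
            l powr (k + 1) * act_vec B (rescale l \<psi>)"
          by (simp add: eventually_mono)
      qed
      then show "deg_vec r B < ereal c"
        unfolding deg_vec_less using k(1) by (intro exI[of _ "k + 1"]) auto
    qed
  next
    assume *: "(\<forall>i. \<forall>\<phi>\<in>test_functions (\<Omega> - {0}). residual \<sigma> B i \<phi> = 0) \<and>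
      (\<forall>\<alpha>. ereal (real (mi_order \<alpha>)) \<le> deg_sym r \<sigma> + 1 \<longrightarrow> residual \<sigma> B 1 (w \<alpha>) = 0) \<and>
      (\<forall>\<alpha>. ereal (real (mi_order \<alpha>)) \<le> deg_sym r \<sigma> + 1 \<longrightarrow> residual \<sigma> B 2 (w \<alpha>) = 0) \<and>
      deg_vec r B \<le> deg_sym r \<sigma> + 1"
    have low: "residual \<sigma> B i (w \<alpha>) = 0" if "ereal (real (mi_order \<alpha>)) \<le> deg_sym r \<sigma> + 1" for i \<alpha>
      using * that exhaust_2[of i] by metis
    show "\<forall>i. \<forall>\<phi>\<in>test_functions \<Omega>. residual \<sigma> B i \<phi> = 0"
    proof (intro allI ballI)
      fix i \<phi> assume \<phi>: "\<phi> \<in> test_functions \<Omega>"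
      have conc: "residual \<sigma> B i \<phi> = 0" if "\<phi> \<in> test_functions (\<Omega> - {0})" for \<phi>
        using * that by blast
      have lim: "((\<lambda>l. l powr real (mi_order \<alpha> + 2) * residual \<sigma> B i (rescale l \<phi>)) \<longlongrightarrow> 0) (at_right 0)"
        if nz: "residual \<sigma> B i (w \<alpha>) \<noteq> 0" and \<phi>: "\<phi> \<in> test_functions (ball 0 r)" for \<alpha> \<phi>
      proof -
        have "deg_sym r \<sigma> + 1 < ereal (real (mi_order \<alpha>))" using low nz by (meson not_le)
        moreover from this have "deg_vec r B < ereal (real (mi_order \<alpha>))"
          using * by (meson le_less_trans)
        ultimately show ?thesis using res_tendsto[OF _ _ \<phi>, of "real (mi_order \<alpha>)" i] by (simp add: add.commute)
      qed
      show "residual \<sigma> B i \<phi> = 0"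
        by (rule concentrated_eq_0[OF \<Omega> r residual_test_linear residual_locally_finite_order conc w lim \<phi>])
          (use lin ord in auto)
    qed
  qed
qed

end
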